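(* Let $G$ be a graph on $n$ vertices satisfying property $\mathcal{P}(d,k,t)$, where $d \geq \log^8 n$ and $k \leq \log n$, and let $\epsilon,\delta>0$ satisfy $$(2k\epsilon)^{1/k} + \delta + \frac1k \leq 1.$$ Then for any tree $T$ of maximum degree at most $\delta d$ and size at most $\epsilon t$, Algorithm 4 (described in the context) finds an embedding of $T$ in $G$ with high probability (probability tending to $1$ as $n\to\infty$).
   Context: Logarithms are natural. For positive integers $d,k,t$, a graph $G$ on $n$ vertices satisfies property $\mathcal{P}(d,k,t)$ if: (1) $G$ has minimum degree at least $d$; (2) for any $u,v\in V(G)$ the number $P_k(u,v)$ of paths of length $k$ (i.e. with $k$ edges) from $u$ to $v$ satisfies $P_k(u,v)\leq d^{1/4}$; (3) for any $u,v\in V(G)$ the number of paths of length $k+1$ from $u$ to $v$ satisfies $P_{k+1}(u,v)\leq d^{k+1}/t$. An embedding of $T$ in $G$ is an injective map $f:V(T)\to V(G)$ mapping edges to edges. Algorithm 4: let $T$ be rooted at $r$. Starting from an arbitrary vertex $v_0\in V(G)$, make $k$ random moves, in each step choosing $v_{i+1}$ uniformly at random from $N(v_i)$, and embed the root at $f(r)=v_k$. As long as $T$ is not completely embedded, take an arbitrary vertex $u\in V(T)$ which is embedded but whose children are not. If $f(u)$ has enough neighbors not occupied by other vertices of $T$, embed the children of $u$ one by one, each at a vertex chosen uniformly at random from the currently unoccupied neighbors of $f(u)$; otherwise the algorithm fails. *)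

theory Defs
  imports "HOL-Probability.Probability" "Graph_Theory.Graph_Theory"
begin

text \<open>
  Finite simple graphs are symmetric loop-free digraphs whose arcs are pairs of vertices
  (\<^locale>\<open>pair_graph\<close>), every edge being represented by its two orientations.
  Hence the degree of a vertex is its \<^const>\<open>out_degree\<close>.
\<close>

definition nbrs :: "'a pair_pre_digraph \<Rightarrow> 'a \<Rightarrow> 'a set" where
  "nbrs G v = {w. (v, w) \<in> parcs G}"

text \<open>
  Paths have pairwise distinct vertices; in particular there is no path of positive length
  from a vertex to itself.
\<close>

definition num_paths :: "'a pair_pre_digraph \<Rightarrow> nat \<Rightarrow> 'a \<Rightarrow> 'a \<Rightarrow> nat" where
  "num_paths G l u v = card {p. pre_digraph.apath (with_proj G) u p v \<and> length p = l}"

definition property_P :: "nat \<Rightarrow> nat \<Rightarrow> nat \<Rightarrow> 'a pair_pre_digraph \<Rightarrow> bool" where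
  "property_P d k t G \<longleftrightarrow>
     (\<forall>v\<in>pverts G. d \<le> out_degree (with_proj G) v) \<and>
     (\<forall>u\<in>pverts G. \<forall>v\<in>pverts G. real (num_paths G k u v) \<le> real d powr (1/4)) \<and>
     (\<forall>u\<in>pverts G. \<forall>v\<in>pverts G. real (num_paths G (k + 1) u v) \<le> real d ^ (k + 1) / real t)"

text \<open>
  The library constant \<^const>\<open>tree\<close> counts the two orientations of one edge as a cycle,
  so it does not describe undirected trees; cycles of length 2 have to be disregarded here.
\<close>

definition is_tree :: "'a pair_pre_digraph \<Rightarrow> bool" where
  "is_tree T \<longleftrightarrow> pair_graph T \<and> Digraph_Component.connected (with_proj T) \<and>
     \<not> (\<exists>p. pre_digraph.cycle (with_proj T) p \<and> 3 \<le> length p)"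

text \<open>The children of \<open>u\<close> are the \<open>w\<close> for which the path from the root \<open>r\<close> to \<open>w\<close> ends with the edge \<open>uw\<close>.\<close>

definition children :: "'a pair_pre_digraph \<Rightarrow> 'a \<Rightarrow> 'a \<Rightarrow> 'a set" where
  "children T r u = {w. \<exists>p. pre_digraph.apath (with_proj T) r (p @ [(u, w)]) w}"

definition is_embedding ::
    "'a pair_pre_digraph \<Rightarrow> 'v pair_pre_digraph \<Rightarrow> ('a \<rightharpoonup> 'v) \<Rightarrow> bool" where
  "is_embedding T G f \<longleftrightarrow>
     dom f = pverts T \<and> ran f \<subseteq> pverts G \<and> inj_on f (pverts T) \<and>
     (\<forall>(x, y)\<in>parcs T. (the (f x), the (f y)) \<in> parcs G)"

text \<open>The vertices \<open>[v\<^sub>0, \<dots>, v\<^sub>k]\<close> visited in \<open>k\<close> random moves.\<close>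

primrec random_walk :: "'v pair_pre_digraph \<Rightarrow> nat \<Rightarrow> 'v \<Rightarrow> 'v list pmf" where
  "random_walk G 0 v = return_pmf [v]"
| "random_walk G (Suc k) v =
     bind_pmf (pmf_of_set (nbrs G v)) (\<lambda>w. map_pmf (Cons v) (random_walk G k w))"

text \<open>
  A state of the algorithm is a partial map \<open>f\<close>: embedded vertices are \<open>dom f\<close>, occupied ones
  \<open>ran f\<close>. The list contains the children still to be embedded into the neighborhood of \<open>x\<close>.
\<close>

primrec embed_children ::
    "'v pair_pre_digraph \<Rightarrow> 'v \<Rightarrow> 'a list \<Rightarrow> ('a \<rightharpoonup> 'v) \<Rightarrow> ('a \<rightharpoonup> 'v) pmf" where
  "embed_children G x [] f = return_pmf f"
| "embed_children G x (c # cs) f =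
     bind_pmf (pmf_of_set (nbrs G x - ran f)) (\<lambda>y. embed_children G x cs (f(c \<mapsto> y)))"

text \<open>
  The algorithm leaves open which vertex \<open>u\<close> is processed next and in which order its children
  are embedded. Therefore \<open>run_law T G r f p\<close> says that \<open>p\<close> is the law of the outcome, from
  state \<open>f\<close> on, under some way of making these choices. As \<open>D\<close> and the derivations for the
  possible successor states \<open>g\<close> are arbitrary, choices may depend on the whole history of the
  run. Failure is the outcome \<^const>\<open>None\<close>.
\<close>

inductive run_law ::
    "'a pair_pre_digraph \<Rightarrow> 'v pair_pre_digraph \<Rightarrow> 'a \<Rightarrow> ('a \<rightharpoonup> 'v) \<Rightarrow> ('a \<rightharpoonup> 'v) spmf \<Rightarrow> bool"
  for T :: "'a pair_pre_digraph" and G :: "'v pair_pre_digraph" and r :: 'a where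
  finished: "pverts T \<subseteq> dom f \<Longrightarrow> run_law T G r f (return_spmf f)"
| failed: "u \<in> dom f \<Longrightarrow> children T r u \<noteq> {} \<Longrightarrow> children T r u \<inter> dom f = {} \<Longrightarrow>
    card (nbrs G (the (f u)) - ran f) < card (children T r u) \<Longrightarrow>
    run_law T G r f (return_pmf None)"
| step: "u \<in> dom f \<Longrightarrow> children T r u \<noteq> {} \<Longrightarrow> children T r u \<inter> dom f = {} \<Longrightarrow>
    card (children T r u) \<le> card (nbrs G (the (f u)) - ran f) \<Longrightarrow>
    set cs = children T r u \<Longrightarrow> distinct cs \<Longrightarrow>
    (\<forall>g\<in>set_pmf (embed_children G (the (f u)) cs f). run_law T G r g (D g)) \<Longrightarrow>
    run_law T G r f (bind_pmf (embed_children G (the (f u)) cs f) D)"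

text \<open>\<open>p\<close> is the law of the outcome of the whole algorithm for some admissible choices.\<close>

definition algorithm_law ::
    "'a pair_pre_digraph \<Rightarrow> 'v pair_pre_digraph \<Rightarrow> 'a \<Rightarrow> nat \<Rightarrow> 'v \<Rightarrow> ('a \<rightharpoonup> 'v) spmf \<Rightarrow> bool" where
  "algorithm_law T G r k v0 p \<longleftrightarrow>
     (\<exists>D. (\<forall>ws\<in>set_pmf (random_walk G k v0). run_law T G r [r \<mapsto> last ws] (D ws)) \<and>
          p = bind_pmf (random_walk G k v0) D)"

end

theory Submission
  imports Defs "HOL-Real_Asymp.Real_Asymp"
begin

text \<open>
  While no neighborhood is too full, each step of the algorithm reaches a prescribed vertex with
  probability at most \<open>q = 1 / ((1 - \<delta> - 1 / k) d)\<close>. The algorithm can only get stuck at a vertex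
  \<open>v\<close> if more than \<open>d / k\<close> neighbors of \<open>v\<close> are occupied before the children of the preimage of
  \<open>v\<close> are embedded, so only tree vertices whose path from the root avoids \<open>v\<close> matter.
  Those of depth less than \<open>k\<close> yield distinct paths of length at most \<open>k\<close> from the image of the
  root to \<open>v\<close>. Extending shorter paths to length \<open>k\<close> shows that there are at most
  \<open>2 d powr (1 / 4)\<close> of each length, so the position of the root, hence the initial random walk,
  is irrelevant.

  The remaining vertices are grouped in blocks, one for each \<open>y\<close>, consisting of the descendants
  \<open>k - 1\<close> levels below \<open>y\<close>, and the blocks in classes according to the depth of \<open>y\<close> modulo \<open>k\<close>.
  Counting paths of length \<open>k + 1\<close> bounds the expected number of neighbors of \<open>v\<close> that a block
  occupies, while counting paths of length \<open>k\<close> bounds the actual number by \<open>d powr (1 / 4)\<close>. Every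
  step affects a single block of each class, so the product of \<open>1 + \<mu> w\<close> over a class, where \<open>w\<close>
  bounds the conditional expectation for a block, is a supermartingale. It dominates the exponential
  moment of the number of neighbors of \<open>v\<close> occupied by the class, and Markov's inequality gives the
  required tail bound.
\<close>

section \<open>Neighborhoods, root paths and children in undirected trees\<close>

lemma (in pair_graph) nbrs_subset: "nbrs G v \<subseteq> pverts G"
  by (auto simp: nbrs_def dest: in_arcsD2)

lemma (in pair_graph) finite_nbrs [simp]: "finite (nbrs G v)"
  using finite_subset[OF nbrs_subset pair_finite_verts] .

lemma (in pair_graph) not_in_own_nbrs [simp]: "v \<notin> nbrs G v"
  using pair_no_loops by (fastforce simp: nbrs_def)

lemma (in pair_graph) nbrs_sym: "w \<in> nbrs G v \<longleftrightarrow> v \<in> nbrs G w"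
  using pair_sym_arcs by (auto simp: nbrs_def symmetric_def dest: symD)

lemma (in pair_graph) out_degree_eq_card_nbrs: "out_degree (with_proj G) v = card (nbrs G v)"
proof -
  have "out_arcs (with_proj G) v = Pair v ` nbrs G v"
    by (auto simp: out_arcs_def nbrs_def)
  then show ?thesis
    by (simp add: out_degree_def card_image inj_on_def)
qed

lemma (in pair_graph) children_iff:
  "w \<in> children G r u \<longleftrightarrow>
    (\<exists>p. apath r p u \<and> w \<notin> set (pawalk_verts r p) \<and> (u, w) \<in> parcs G)"
proof -
  have "apath r (p @ [(u, w)]) w \<longleftrightarrow>
      apath r p u \<and> w \<notin> set (pawalk_verts r p) \<and> (u, w) \<in> parcs G" for p
  proof (cases "apath r p (last (pawalk_verts r p))")
    case True
    then have "apath r p u \<longleftrightarrow> last (pawalk_verts r p) = u"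
      by (auto simp: apath_def)
    then show ?thesis
      using True in_arcsD2 pair_no_loops
      by (fastforce simp: apath_append_iff apath_Cons_iff apath_Nil_iff)
  next
    case False
    then have "\<not> apath r p u"
      by (auto simp: apath_def)
    moreover have "\<not> apath r (p @ [(u, w)]) w"
      using False by (simp only: apath_append_iff) simp
    ultimately
    show ?thesis by blast
  qed
  then show ?thesis by (simp add: children_def)
qed

lemma (in pair_graph) children_subset_nbrs: "children G r u \<subseteq> nbrs G u"
  by (auto simp: children_iff nbrs_def)

text \<open>Both \<open>u\<close> and \<open>u'\<close> are reachable from the root without passing
  through \<open>w\<close>. If they differed, a path between them avoiding \<open>w\<close> could be
  closed through \<open>w\<close> to a cycle.\<close>

lemma (in pair_graph) parent_unique:
  assumes tree: "is_tree G" and w: "w \<in> children G r u" "w \<in> children G r u'"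
  shows "u = u'"
proof (rule ccontr)
  assume "u \<noteq> u'"
  obtain p where p: "apath r p u" "w \<notin> set (pawalk_verts r p)" "(u, w) \<in> parcs G"
    using w(1) by (auto simp: children_iff)
  obtain p' where p': "apath r p' u'" "w \<notin> set (pawalk_verts r p')" "(u', w) \<in> parcs G"
    using w(2) by (auto simp: children_iff)
  \<comment> \<open>\<open>H\<close> is \<open>G\<close> with \<open>w\<close> deleted. It is still
    symmetric, so the two root paths can be joined at \<open>r\<close> into a path from
    \<open>u\<close> to \<open>u'\<close>.\<close>
  define H where "H = \<lparr>pverts = pverts G - {w}, parcs = {(x, y) \<in> parcs G. x \<noteq> w \<and> y \<noteq> w}\<rparr>"
  have pverts_H: "pverts H = pverts G - {w}"
    and parcs_H: "(x, y) \<in> parcs H \<longleftrightarrow> (x, y) \<in> parcs G \<and> x \<noteq> w \<and> y \<noteq> w" for x y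
    by (auto simp: H_def)
  have "sym (parcs H)"
    using nbrs_sym by (auto simp: sym_def parcs_H nbrs_def)
  then interpret H: pair_sym_digraph H
    by unfold_locales (auto simp: pverts_H parcs_H symmetric_def dest: in_arcsD1 in_arcsD2)
  have H_awalk: "H.awalk x q y"
    if "awalk x q y" "w \<notin> set (pawalk_verts x q)" for x q y
    using that
  proof (induction q arbitrary: x)
    case Nil
    then show ?case by (auto simp: awalk_simps H.awalk_simps pverts_H)
  next
    case (Cons e q)
    then have "H.awalk (snd e) q y" by (auto simp: awalk_simps)
    moreover have "snd e \<noteq> w"
      using Cons.prems by (cases q) (auto simp: awalk_simps)
    ultimately show ?case
      using Cons.prems by (cases e) (auto simp: awalk_simps H.awalk_simps parcs_H)
  qed
  have "H.awalk r p u" "H.awalk r p' u'"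
    using p p' by (auto intro!: H_awalk awalkI_apath)
  then have "r \<rightarrow>\<^sup>*\<^bsub>H\<^esub> u" "r \<rightarrow>\<^sup>*\<^bsub>H\<^esub> u'"
    by (auto simp: H.reachable_awalk)
  then have "u \<rightarrow>\<^sup>*\<^bsub>H\<^esub> u'"
    using H.sym_arcs symmetric_reachable H.reachable_trans by metis
  then obtain q where q: "H.apath u q u'"
    by (auto simp: H.reachable_apath)
  have "q \<noteq> []"
    using q \<open>u \<noteq> u'\<close> by (auto simp: H.apath_Nil_iff)
  have "awalk x q y" if "H.awalk x q y" for x q y
    using that by (auto simp: awalk_def H.awalk_def pverts_H parcs_H)
  then have aq: "awalk u q u'" "w \<notin> set (pawalk_verts u q)" "distinct (pawalk_verts u q)"
    using q pverts_H by (auto simp: H.apath_def elim!: H.awalkE)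
  let ?c = "(w, u) # q @ [(u', w)]"
  have "(w, u) \<in> parcs G" "w \<in> pverts G"
    using p(3) nbrs_sym by (auto simp: nbrs_def dest: in_arcsD2)
  then have "awalk w ?c w"
    using aq p' by (auto simp: awalk_simps awalk_append_iff dest: in_arcsD2)
  moreover have "pawalk_verts u (q @ [(u', w)]) = pawalk_verts u q @ [w]"
    using awalk_verts_append[of u q "[(u', w)]" w] aq p' by (auto simp: awalk_simps dest: in_arcsD2)
  then have "distinct (tl (pawalk_verts w ?c))"
    using aq by auto
  ultimately have "cycle ?c" by (auto simp: cycle_def)
  \<comment> \<open>Two arcs at \<open>w\<close> and at least one arc of \<open>q\<close>, so this
    is not just one edge traversed back and forth.\<close>
  moreover have "3 \<le> length ?c"
    using \<open>q \<noteq> []\<close> by (cases q) auto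
  ultimately show False using tree by (auto simp: is_tree_def)
qed

text \<open>The last arc is determined by \<open>parent_unique\<close>; removing it from both paths
  gives the induction.\<close>

lemma (in pair_graph) apath_unique:
  assumes "is_tree G" "apath r p w" "apath r p' w"
  shows "p = p'"
  using assms(2,3)
proof (induction p arbitrary: w p' rule: rev_induct)
  case Nil
  then show ?case using apath_nonempty_ends by (auto simp: apath_Nil_iff)
next
  case (snoc e p)
  have "p' \<noteq> []"
    using snoc.prems apath_nonempty_ends by (auto simp: apath_Nil_iff)
  then obtain p2 e2 where p': "p' = p2 @ [e2]"
    by (meson rev_exhaust)
  have e: "e = (fst e, w)" "e2 = (fst e2, w)"
    using snoc.prems
    by (cases e; cases e2; auto simp: p' apath_append_iff apath_Cons_iff apath_Nil_iff)+
  have "w \<in> children G r (fst e)" "w \<in> children G r (fst e2)"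
    using snoc.prems e(1) snoc.prems[unfolded p'] e(2) unfolding children_def by auto
  then have "e = e2" using parent_unique[OF assms(1)] e by metis
  moreover have "apath r p (fst e)" "apath r p2 (fst e2)"
    using snoc.prems by (auto simp: p' apath_append_iff apath_Cons_iff)
  ultimately show ?case using snoc.IH p' by auto
qed

lemma (in pair_graph) tree_reachable:
  assumes "is_tree G" "r \<in> pverts G" "w \<in> pverts G"
  obtains p where "apath r p w"
proof -
  have "strongly_connected (with_proj G)"
    using assms(1) symmetric_connected_imp_strongly_connected pair_sym_arcs by (auto simp: is_tree_def)
  then show ?thesis
    using that assms(2,3) by (auto simp: strongly_connected_def reachable_apath)
qed

text \<open>If the root path of \<open>x\<close> misses \<open>y\<close>, it extends to
  \<open>y\<close>. Otherwise its part from \<open>y\<close> to \<open>x\<close>, closed by the arc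
  \<open>(x, y)\<close>, would be a cycle unless it is a single arc, and then \<open>y\<close> is
  the parent of \<open>x\<close>.\<close>

lemma (in pair_graph) tree_arc_cases:
  assumes tree: "is_tree G" and r: "r \<in> pverts G" and xy: "(x, y) \<in> parcs G"
  shows "y \<in> children G r x \<or> x \<in> children G r y"
proof -
  obtain p where p: "apath r p x"
    using tree_reachable[OF tree r] xy in_arcsD1 by blast
  show ?thesis
  proof (cases "y \<in> set (pawalk_verts r p)")
    case False
    then show ?thesis using p xy by (auto simp: children_iff)
  next
    case True
    obtain p1 p2 where p12: "p = p1 @ p2" "awalk r p1 y" "awalk y p2 x"
      using awalk_decomp[OF awalkI_apath[OF p] True] by blast
    have "apath (last (pawalk_verts r p1)) p2 x"
      using p p12 by (simp only: apath_append_iff)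
    then have d: "distinct (pawalk_verts y p2)"
      using p12 by (simp add: apath_def)
    have "x \<noteq> y" using pair_no_loops[OF xy] by auto
    then have "p2 \<noteq> []" using p12(3) by (auto simp: awalk_simps)
    have "length p2 < 2"
    proof (rule ccontr)
      assume "\<not> length p2 < 2"
      moreover have "awalk y (p2 @ [(x, y)]) y"
        using p12(3) xy by (auto simp: awalk_simps dest: in_arcsD2)
      moreover have "pawalk_verts y (p2 @ [(x, y)]) = pawalk_verts y p2 @ [y]"
        using awalk_verts_append[of y p2 "[(x, y)]" y] p12(3) xy
        by (auto simp: awalk_simps dest: in_arcsD2)
      moreover have "y \<notin> set (tl (pawalk_verts y p2))"
        using d p12(3) awhd_of_awalk[OF p12(3)] by (cases "pawalk_verts y p2") auto
      ultimately have "cycle (p2 @ [(x, y)])"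
        using d by (cases "pawalk_verts y p2") (auto simp: cycle_def intro!: exI[of _ y])
      then show False
        using tree \<open>\<not> length p2 < 2\<close> by (auto simp: is_tree_def)
    qed
    then obtain e where "p2 = [e]" using \<open>p2 \<noteq> []\<close> by (cases p2) auto
    then have "apath r (p1 @ [(y, x)]) x"
      using p p12 by (cases e) (auto simp: awalk_simps)
    then show ?thesis by (auto simp: children_def)
  qed
qed

section \<open>Rooted trees\<close>

text \<open>The value of the parent function \<open>par\<close> at the root is irrelevant.\<close>

locale rooted_tree =
  fixes Ch :: "'a \<Rightarrow> 'a set" and V :: "'a set" and r :: 'a
    and par :: "'a \<Rightarrow> 'a" and dep :: "'a \<Rightarrow> nat"
  assumes finite_V [simp]: "finite V"
    and root_in_V [simp]: "r \<in> V"
    and dep_root [simp]: "dep r = 0"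
    and Ch_subset: "u \<in> V \<Longrightarrow> Ch u \<subseteq> V"
    and par_Ch: "u \<in> V \<Longrightarrow> c \<in> Ch u \<Longrightarrow> par c = u"
    and dep_Ch: "u \<in> V \<Longrightarrow> c \<in> Ch u \<Longrightarrow> dep c = Suc (dep u)"
    and par_in_V: "y \<in> V \<Longrightarrow> y \<noteq> r \<Longrightarrow> par y \<in> V"
    and in_Ch_par: "y \<in> V \<Longrightarrow> y \<noteq> r \<Longrightarrow> y \<in> Ch (par y)"

lemma (in pair_graph) rooted_tree_children:
  assumes tree: "is_tree G" and r: "r \<in> pverts G"
  obtains par dep where "rooted_tree (children G r) (pverts G) r par dep"
proof -
  \<comment> \<open>Root paths and parents are unique in a tree, so both descriptions are well
    defined wherever such an object exists.\<close>
  define dep where "dep w = length (THE p. apath r p w)" for w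
  define par where "par w = (THE u. w \<in> children G r u)" for w
  have dep: "dep w = length p" if "apath r p w" for p w
    using that apath_unique[OF tree _ that] unfolding dep_def by (metis the_equality)
  have par: "par w = u" if "w \<in> children G r u" for w u
    using that parent_unique[OF tree _ that] unfolding par_def by (metis the_equality)
  have ex: "\<exists>u\<in>pverts G. w \<in> children G r u" if w: "w \<in> pverts G" "w \<noteq> r" for w
  proof -
    obtain p where p: "apath r p w" using tree_reachable[OF tree r w(1)] .
    then have "p \<noteq> []" using w by (auto simp: apath_Nil_iff)
    then obtain p' e where "p = p' @ [e]" by (meson rev_exhaust)
    with p have "apath r (p' @ [(fst e, w)]) w" "fst e \<in> pverts G"
      by (cases e; auto simp: apath_append_iff apath_Cons_iff apath_Nil_iff dest: in_arcsD1)+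
    then show ?thesis by (auto simp: children_def)
  qed
  have "rooted_tree (children G r) (pverts G) r par dep"
  proof
    show "dep r = 0" using dep[of "[]"] r by (auto simp: apath_Nil_iff)
  next
    fix u c assume u: "u \<in> pverts G" and c: "c \<in> children G r u"
    then obtain p where "apath r (p @ [(u, c)]) c" by (auto simp: children_def)
    moreover from this have "apath r p u" by (auto simp: apath_append_iff apath_Cons_iff)
    ultimately show "dep c = Suc (dep u)" by (auto simp: dep)
  next
    fix u show "children G r u \<subseteq> pverts G"
      using children_subset_nbrs nbrs_subset by blast
  qed (use par ex r pair_finite_verts in \<open>force+\<close>)
  then show ?thesis by (rule that)
qed

context rooted_tree
begin

text \<open>The descendants of \<open>y\<close> exactly \<open>i\<close> generations below
  it.\<close>

primrec lev :: "nat \<Rightarrow> 'a \<Rightarrow> 'a set" where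
  "lev 0 y = {y}"
| "lev (Suc i) y = (\<Union>c\<in>Ch y. lev i c)"

lemma finite_Ch: "u \<in> V \<Longrightarrow> finite (Ch u)"
  using Ch_subset finite_V finite_subset by blast

lemma root_not_Ch: "u \<in> V \<Longrightarrow> r \<notin> Ch u"
  using dep_Ch dep_root by fastforce

lemma not_self_Ch: "u \<in> V \<Longrightarrow> u \<notin> Ch u"
  using dep_Ch by fastforce

lemma dep_pos: "y \<in> V \<Longrightarrow> y \<noteq> r \<Longrightarrow> dep y > 0"
  using dep_Ch[OF par_in_V in_Ch_par] by auto

lemma lev_subset: "y \<in> V \<Longrightarrow> lev i y \<subseteq> V"
proof (induction i arbitrary: y)
  case (Suc i)
  then show ?case using Ch_subset by (fastforce simp: UN_subset_iff)
qed simp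

lemma finite_lev: "y \<in> V \<Longrightarrow> finite (lev i y)"
  using lev_subset finite_V finite_subset by blast

lemma lev_par: "y \<in> V \<Longrightarrow> x \<in> lev i y \<Longrightarrow> (par ^^ i) x = y"
proof (induction i arbitrary: y)
  case (Suc i)
  then obtain c where c: "c \<in> Ch y" "x \<in> lev i c" by auto
  then have "(par ^^ i) x = c" using Suc Ch_subset by blast
  then show ?case using par_Ch[OF Suc.prems(1) c(1)] by simp
qed simp

lemma lev_dep: "y \<in> V \<Longrightarrow> x \<in> lev i y \<Longrightarrow> dep x = dep y + i"
proof (induction i arbitrary: y)
  case (Suc i)
  then obtain c where c: "c \<in> Ch y" "x \<in> lev i c" by auto
  then have "dep x = dep c + i" using Suc Ch_subset by blast
  then show ?case using dep_Ch[OF Suc.prems(1) c(1)] by simp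
qed simp

lemma funpow_par: "x \<in> V \<Longrightarrow> i \<le> dep x \<Longrightarrow> (par ^^ i) x \<in> V \<and> x \<in> lev i ((par ^^ i) x)"
proof (induction i)
  case (Suc i)
  let ?y = "(par ^^ i) x"
  have y: "?y \<in> V" "x \<in> lev i ?y" using Suc by auto
  then have "dep x = dep ?y + i" using lev_dep by blast
  then have "?y \<noteq> r" using Suc.prems dep_root by (metis Suc_n_not_le_n add_0)
  then show ?case using y par_in_V in_Ch_par by auto
qed simp

lemma lev_disjoint: "y \<in> V \<Longrightarrow> y' \<in> V \<Longrightarrow> y \<noteq> y' \<Longrightarrow> lev i y \<inter> lev i y' = {}"
  using lev_par by blast

text \<open>The root path of \<open>y\<close> read upwards. Putting \<open>y\<close> at the head
  makes passing to a child a \<open>Cons\<close>, as the recursion of \<open>ext\<close>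
  requires.\<close>

definition anc :: "'a \<Rightarrow> 'a list" where
  "anc y = map (\<lambda>i. (par ^^ i) y) [0..<Suc (dep y)]"

lemma anc_root: "anc r = [r]"
  by (simp add: anc_def)

lemma anc_Ch: "u \<in> V \<Longrightarrow> c \<in> Ch u \<Longrightarrow> anc c = c # anc u"
proof -
  assume u: "u \<in> V" "c \<in> Ch u"
  have "anc c = c # map (\<lambda>i. (par ^^ Suc i) c) [0..<Suc (dep u)]"
    unfolding anc_def dep_Ch[OF u] 
    by (subst upt_rec) (simp add: map_Suc_upt[symmetric] comp_def del: upt_Suc funpow.simps)
  also have "(\<lambda>i. (par ^^ Suc i) c) = (\<lambda>i. (par ^^ i) u)"
    using par_Ch[OF u] by (auto simp: funpow_Suc_right simp del: funpow.simps)
  finally show ?thesis by (simp only: anc_def)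
qed

lemma anc_neq_Nil [simp]: "anc y \<noteq> []"
  by (simp add: anc_def)

lemma hd_anc [simp]: "hd (anc y) = y"
  unfolding anc_def by (subst upt_rec) (simp del: upt_Suc)

lemma dep_anc: "y \<in> V \<Longrightarrow> x \<in> set (anc y) \<Longrightarrow> x \<in> V \<and> dep x \<le> dep y"
proof -
  assume y: "y \<in> V" and "x \<in> set (anc y)"
  then obtain i where i: "i \<le> dep y" "x = (par ^^ i) y"
    by (auto simp: anc_def less_Suc_eq_le simp del: upt_Suc)
  then show ?thesis
    using funpow_par[OF y i(1)] lev_dep[of x y i] by auto
qed

end

section \<open>Path counts along an embedded branch\<close>

text \<open>
  Vertex lists grow at the head: \<open>ext G v l L\<close> counts the paths with \<open>l\<close> edges from \<open>hd L\<close> to \<open>v\<close>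
  that avoid the other entries of \<open>L\<close>.
\<close>

primrec ext :: "'v pair_pre_digraph \<Rightarrow> 'v \<Rightarrow> nat \<Rightarrow> 'v list \<Rightarrow> nat" where
  "ext G v 0 L = (if hd L = v then 1 else 0)"
| "ext G v (Suc l) L = (\<Sum>z\<in>nbrs G (hd L) - set L. ext G v l (z # L))"

declare ext.simps(2) [simp del]

context pair_graph
begin

lemma finite_apaths [simp]: "finite {p. apath u p v \<and> Q p}"
  using apaths_finite[of u v] by (rule rev_finite_subset) auto

text \<open>Paths are sorted by their first arc \<open>(z, y)\<close>; different \<open>y\<close>
  give disjoint families, and \<open>z\<close> joins the forbidden vertices for the
  remainder.\<close>

lemma ext_le_card:
  assumes "z \<in> pverts G" "z \<notin> set S"
  shows "ext G v l (z # S) \<le> card {p. apath z p v \<and> length p = l \<and> set (pawalk_verts z p) \<inter> set S = {}}"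
  using assms
proof (induction l arbitrary: z S)
  case 0
  have "{p. apath z p v \<and> length p = 0 \<and> set (pawalk_verts z p) \<inter> set S = {}}
      = (if z = v then {[]} else {})"
    using 0 by (auto simp: apath_Nil_iff)
  then show ?case by simp
next
  case (Suc l)
  define A where "A y R m = {p. apath y p v \<and> length p = m \<and> set (pawalk_verts y p) \<inter> set R = {}}" for y R m
  let ?N = "nbrs G z - set (z # S)"
  have fin: "finite (A y R m)" for y R m by (simp add: A_def)
  have "ext G v (Suc l) (z # S) = (\<Sum>y\<in>?N. ext G v l (y # z # S))"
    by (simp add: ext.simps(2))
  also have "\<dots> \<le> (\<Sum>y\<in>?N. card (A y (z # S) l))"
    unfolding A_def using nbrs_subset by (intro sum_mono Suc.IH) auto
  also have "\<dots> = (\<Sum>y\<in>?N. card (Cons (z, y) ` A y (z # S) l))"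
    by (simp add: card_image)
  also have "\<dots> = card (\<Union>y\<in>?N. Cons (z, y) ` A y (z # S) l)"
    by (rule card_UN_disjoint[symmetric]) (use fin in auto)
  also have "\<dots> \<le> card (A z S (Suc l))"
    using Suc.prems by (intro card_mono fin) (auto simp: A_def nbrs_def apath_Cons_iff)
  finally show ?case by (simp add: A_def)
qed

lemma ext_le_num_paths:
  assumes "z \<in> pverts G" "z \<notin> set S"
  shows "ext G v l (z # S) \<le> num_paths G l z v"
proof -
  have "ext G v l (z # S) \<le> card {p. apath z p v \<and> length p = l \<and> set (pawalk_verts z p) \<inter> set S = {}}"
    using ext_le_card[OF assms] .
  also have "\<dots> \<le> num_paths G l z v"
    unfolding num_paths_def by (intro card_mono) auto
  finally show ?thesis .
qed

lemma sum_ext_le: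
  "A \<subseteq> nbrs G (hd L) - set L \<Longrightarrow> (\<Sum>z\<in>A. ext G v l (z # L)) \<le> ext G v (Suc l) L"
  by (auto simp: ext.simps(2) intro!: sum_mono2)

lemma ext_1: "ext G v (Suc 0) L = (if v \<in> nbrs G (hd L) \<and> v \<notin> set L then 1 else 0)"
  by (simp add: ext.simps(2) sum.delta')

end

section \<open>Auxiliary facts on products, residues and exponentials\<close>

lemma sum_prod_one_factor:
  fixes a :: "'y \<Rightarrow> 'z \<Rightarrow> real"
  assumes "finite A" "y0 \<in> A"
    and "\<And>y z. y \<in> A \<Longrightarrow> y \<noteq> y0 \<Longrightarrow> z \<in> F \<Longrightarrow> a y z = b y"
    and "\<And>y. y \<in> A \<Longrightarrow> 0 \<le> b y"
    and "(\<Sum>z\<in>F. a y0 z) \<le> N * b y0"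
  shows "(\<Sum>z\<in>F. \<Prod>y\<in>A. a y z) \<le> N * (\<Prod>y\<in>A. b y)"
proof -
  have "(\<Sum>z\<in>F. \<Prod>y\<in>A. a y z) = (\<Sum>z\<in>F. a y0 z * (\<Prod>y\<in>A - {y0}. b y))"
    using assms by (intro sum.cong refl) (simp add: prod.remove[of A y0])
  also have "\<dots> = (\<Sum>z\<in>F. a y0 z) * (\<Prod>y\<in>A - {y0}. b y)"
    by (simp add: sum_distrib_right)
  also have "\<dots> \<le> N * b y0 * (\<Prod>y\<in>A - {y0}. b y)"
    using assms by (intro mult_right_mono prod_nonneg) auto
  also have "\<dots> = N * (\<Prod>y\<in>A. b y)"
    using assms by (simp add: prod.remove[of A y0] mult.assoc)
  finally show ?thesis .
qed

text \<open>Over the integers, \<open>k\<close> divides \<open>b - a = i - j\<close>. This serves to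
  show that a tree vertex is within \<open>k - 1\<close> levels below at most one member of a depth
  class.\<close>

lemma mod_add_left_imp_eq:
  fixes a b i j k :: nat
  assumes "a mod k = b mod k" "a + i = b + j"
  shows "i mod k = j mod k"
proof -
  have "int k dvd int b - int a"
    using assms(1) by (simp add: mod_eq_dvd_iff[symmetric] flip: of_nat_mod)
  also have "int b - int a = int i - int j" using assms(2) by linarith
  finally show ?thesis
    by (simp add: mod_eq_dvd_iff[symmetric] flip: of_nat_mod)
qed

text \<open>Uses \<open>exp y \<le> 1 + y + y\<^sup>2\<close> for \<open>0 \<le> y \<le> 1\<close>,
  with one factor of the square bounded by \<open>lam * B\<close>. An exponential moment of a
  bounded count thus becomes linear in the count, so that bounds on conditional expectations can be
  inserted.\<close>

lemma exp_le_linear: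
  fixes lam B x :: real
  assumes "0 \<le> lam" "lam * B \<le> 1" "0 \<le> x" "x \<le> B"
  shows "exp (lam * x) \<le> 1 + lam * (1 + lam * B) * x"
proof -
  have lx: "lam * x \<le> lam * B" using assms by (intro mult_left_mono)
  have "exp (lam * x) \<le> 1 + lam * x + (lam * x)\<^sup>2"
    using assms lx by (intro exp_bound) auto
  also have "(lam * x)\<^sup>2 \<le> lam * x * (lam * B)"
    unfolding power2_eq_square using assms lx by (intro mult_left_mono) auto
  finally show ?thesis by (simp add: algebra_simps)
qed

context rooted_tree
begin

lemma tree_induct [consumes 1, case_names root child]:
  assumes "y \<in> V" "P r" "\<And>u c. u \<in> V \<Longrightarrow> c \<in> Ch u \<Longrightarrow> P u \<Longrightarrow> P c"
  shows "P y"
  using assms(1)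
proof (induction "dep y" arbitrary: y rule: less_induct)
  case less
  show ?case
  proof (cases "y = r")
    case False
    then have "par y \<in> V" "y \<in> Ch (par y)" using less par_in_V in_Ch_par by auto
    then show ?thesis using assms(3) less.hyps[of "par y"] dep_Ch by auto
  qed (use assms in simp)
qed

lemma distinct_anc: "y \<in> V \<Longrightarrow> distinct (anc y)"
proof (induction rule: tree_induct)
  case (child u c)
  then show ?case
    using dep_anc[of u c] by (auto simp: anc_Ch dep_Ch)
qed (simp add: anc_root)

lemma funpow_par_in_anc: "i \<le> dep y \<Longrightarrow> (par ^^ i) y \<in> set (anc y)"
  by (auto simp: anc_def simp del: upt_Suc)

lemma sum_lev_Suc:
  "y \<in> V \<Longrightarrow> sum h (lev (Suc i) y) = (\<Sum>c\<in>Ch y. sum h (lev i c))"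
  unfolding lev.simps
  by (intro sum.UNION_disjoint ballI impI lev_disjoint)
     (auto simp: finite_Ch intro!: finite_lev dest: subsetD[OF Ch_subset])

lemma card_lev_Suc: "y \<in> V \<Longrightarrow> card (lev (Suc i) y) = (\<Sum>c\<in>Ch y. card (lev i c))"
  using sum_lev_Suc[of y "\<lambda>_. 1::nat" i] by simp

end

text \<open>\<open>q\<close> bounds the probability of a step to a prescribed vertex, and
  \<open>C\<close> the expected hits per member of a block that has not started. \<open>B\<close>
  caps the hits of one block, \<open>B\<^sub>0\<close> those of one shallow level.
  \<open>lam\<close> is the parameter of the exponential moment and \<open>s\<close> the deviation
  allowed to each class.\<close>

locale tree_embedding = rooted_tree Ch V r par dep + pair_graph G
  for Ch :: "'a \<Rightarrow> 'a set" and V r par dep and G :: "'v pair_pre_digraph" +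
  fixes k :: nat and q C B B\<^sub>0 lam s :: real
  assumes k_pos: "0 < k" and q_pos: "0 < q" and C_nonneg: "0 \<le> C"
    and lam_nonneg: "0 \<le> lam" and lam_B: "lam * B \<le> 1"
    and num_paths_Suc_k: "u \<in> pverts G \<Longrightarrow> v \<in> pverts G \<Longrightarrow> q ^ k * num_paths G (Suc k) u v \<le> C"
    and num_paths_k: "u \<in> pverts G \<Longrightarrow> v \<in> pverts G \<Longrightarrow> num_paths G k u v \<le> B"
    and num_paths_le: "u \<in> pverts G \<Longrightarrow> v \<in> pverts G \<Longrightarrow> j < k \<Longrightarrow> num_paths G (Suc j) u v \<le> B\<^sub>0"
begin

section \<open>The invariant of the states and the images of root paths\<close>

definition mu :: real where "mu = lam * (1 + lam * B)"

lemma B_nonneg: "0 \<le> B" if "v \<in> pverts G"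
  using num_paths_k[OF that that] by linarith

lemma mu_nonneg: "0 \<le> mu" if "v \<in> pverts G"
  using lam_nonneg B_nonneg[OF that] by (simp add: mu_def)

definition valid :: "('a \<rightharpoonup> 'v) \<Rightarrow> bool" where
  "valid f \<longleftrightarrow> r \<in> dom f \<and> dom f \<subseteq> V \<and> ran f \<subseteq> pverts G \<and> inj_on f (dom f) \<and>
    (\<forall>u\<in>V. \<forall>c\<in>Ch u \<inter> dom f. u \<in> dom f \<and> the (f c) \<in> nbrs G (the (f u)))"

definition trace :: "('a \<rightharpoonup> 'v) \<Rightarrow> 'a \<Rightarrow> 'v list" where
  "trace f y = map (\<lambda>x. the (f x)) (anc y)"

abbreviation free :: "('a \<rightharpoonup> 'v) \<Rightarrow> 'a \<Rightarrow> 'v set" where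
  "free f u \<equiv> nbrs G (the (f u)) - ran f"

lemma validD:
  assumes "valid f"
  shows "r \<in> dom f" "y \<in> dom f \<Longrightarrow> y \<in> V" "y \<in> dom f \<Longrightarrow> the (f y) \<in> pverts G" "inj_on f (dom f)"
    "u \<in> V \<Longrightarrow> c \<in> Ch u \<Longrightarrow> c \<in> dom f \<Longrightarrow> u \<in> dom f"
    "u \<in> V \<Longrightarrow> c \<in> Ch u \<Longrightarrow> c \<in> dom f \<Longrightarrow> the (f c) \<in> nbrs G (the (f u))"
  using assms by (auto simp: valid_def ran_def)

lemma valid_inj: "valid f \<Longrightarrow> x \<in> dom f \<Longrightarrow> y \<in> dom f \<Longrightarrow> the (f x) = the (f y) \<longleftrightarrow> x = y"
  using validD(4)[of f] by (metis domD inj_onD option.sel)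

lemma anc_dom: "valid f \<Longrightarrow> y \<in> dom f \<Longrightarrow> set (anc y) \<subseteq> dom f"
proof -
  assume f: "valid f" and "y \<in> dom f"
  then have "y \<in> V" using validD by blast
  then show ?thesis using \<open>y \<in> dom f\<close>
  proof (induction rule: tree_induct)
    case (child u c)
    then show ?case using validD(5)[OF f] by (auto simp: anc_Ch)
  qed (simp add: anc_root)
qed

lemma trace_Ch: "u \<in> V \<Longrightarrow> c \<in> Ch u \<Longrightarrow> trace f c = the (f c) # trace f u"
  by (simp add: trace_def anc_Ch)

lemma hd_trace [simp]: "hd (trace f y) = the (f y)"
  by (simp add: trace_def hd_map)

lemma trace_subset_ran: "valid f \<Longrightarrow> y \<in> dom f \<Longrightarrow> set (trace f y) \<subseteq> ran f"
  using anc_dom[of f y] by (force simp: trace_def ran_def)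

lemma distinct_trace: "valid f \<Longrightarrow> y \<in> dom f \<Longrightarrow> distinct (trace f y)"
  using anc_dom[of f y] distinct_anc[of y] validD(2)[of f y] valid_inj[of f]
  by (simp add: trace_def distinct_map inj_on_def subset_iff)

lemma ext_trace_le:
  assumes "valid f" "y \<in> dom f"
  shows "ext G v l (trace f y) \<le> num_paths G l (the (f y)) v"
proof -
  obtain S where S: "trace f y = the (f y) # S"
    using hd_trace[of f y] by (cases "trace f y") (auto simp: trace_def)
  then have "the (f y) \<notin> set S"
    using distinct_trace[OF assms] by simp
  then show ?thesis
    using ext_le_num_paths validD(3)[OF assms] S by metis
qed

lemma Ch_not_dom: "valid f \<Longrightarrow> u \<in> V \<Longrightarrow> u \<notin> dom f \<Longrightarrow> c \<in> Ch u \<Longrightarrow> c \<notin> dom f"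
  using validD(5) by blast

lemma lev_not_dom: "valid f \<Longrightarrow> y \<in> V \<Longrightarrow> y \<notin> dom f \<Longrightarrow> lev i y \<inter> dom f = {}"
proof (induction i arbitrary: y)
  case (Suc i)
  then have "lev i c \<inter> dom f = {}" if "c \<in> Ch y" for c
    using Ch_not_dom that Ch_subset by blast
  then show ?case by auto
qed simp

lemma free_subset: "valid f \<Longrightarrow> u \<in> dom f \<Longrightarrow> free f u \<subseteq> nbrs G (hd (trace f u)) - set (trace f u)"
  using trace_subset_ran[of f u] by auto

lemma valid_update:
  assumes f: "valid f" and u: "u \<in> dom f" and c: "c \<in> Ch u" "c \<notin> dom f" and z: "z \<in> free f u"
  shows "valid (f(c \<mapsto> z))"
proof -
  have uV: "u \<in> V" using validD(2)[OF f u] .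
  have cV: "c \<in> V" "c \<noteq> u" using c u Ch_subset[OF uV] by auto
  have "inj_on (f(c \<mapsto> z)) (dom (f(c \<mapsto> z)))"
    using validD(4)[OF f] z c by (auto simp: inj_on_def ran_def)
  moreover have "w \<in> dom (f(c \<mapsto> z)) \<and> the ((f(c \<mapsto> z)) x) \<in> nbrs G (the ((f(c \<mapsto> z)) w))"
    if w: "w \<in> V" "x \<in> Ch w" "x \<in> dom (f(c \<mapsto> z))" for w x
  proof (cases "x = c")
    case True
    then have "w = u" using par_Ch w uV c by metis
    then show ?thesis using True u z cV by auto
  next
    case False
    then have "x \<in> dom f" using w by auto
    then show ?thesis using validD(5,6)[OF f w(1,2)] False c by auto
  qed
  moreover have "ran (f(c \<mapsto> z)) \<subseteq> pverts G"
    using f z c(2) nbrs_subset by (auto simp: valid_def ran_map_upd domIff)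
  moreover have "r \<in> dom (f(c \<mapsto> z))" "dom (f(c \<mapsto> z)) \<subseteq> V"
    using f cV by (auto simp: valid_def)
  ultimately show ?thesis
    unfolding valid_def by blast
qed

lemma trace_update: "valid f \<Longrightarrow> y \<in> dom f \<Longrightarrow> c \<notin> dom f \<Longrightarrow> trace (f(c \<mapsto> z)) y = trace f y"
  using anc_dom[of f y] by (auto simp: trace_def)

section \<open>The potential\<close>

text \<open>
  Bounds the conditional expectation of the number of \<open>x \<in> lev i y\<close> that get embedded in the
  neighborhood of \<open>v\<close> without a previous visit to \<open>v\<close>: every step to a prescribed vertex has
  probability at most \<open>q\<close>.
\<close>

primrec hit_bound :: "'v \<Rightarrow> ('a \<rightharpoonup> 'v) \<Rightarrow> nat \<Rightarrow> 'a \<Rightarrow> real" where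
  "hit_bound v f 0 y = ext G v (Suc 0) (trace f y)"
| "hit_bound v f (Suc i) y = (\<Sum>c\<in>Ch y. if c \<in> dom f then hit_bound v f i c
     else card (lev i c) * q ^ Suc i * ext G v (Suc (Suc i)) (trace f y))"

lemma hit_bound_nonneg: "0 \<le> hit_bound v f i y"
  using q_pos by (induction i arbitrary: y) (auto intro!: sum_nonneg)

lemma hit_bound_fresh:
  assumes "y \<in> V" "Ch y \<inter> dom f = {}"
  shows "hit_bound v f i y = card (lev i y) * q ^ i * ext G v (Suc i) (trace f y)"
proof (cases i)
  case (Suc j)
  have "hit_bound v f (Suc j) y = (\<Sum>c\<in>Ch y. card (lev j c) * q ^ Suc j * ext G v (Suc (Suc j)) (trace f y))"
    unfolding hit_bound.simps using assms by (intro sum.cong) auto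
  then show ?thesis
    unfolding Suc card_lev_Suc[OF assms(1)] by (simp add: sum_distrib_right)
qed simp

text \<open>The recursion inspects only the trace of \<open>y\<close> and the descendants of
  \<open>y\<close> down to level \<open>i\<close>.\<close>

lemma hit_bound_update_other:
  assumes "valid f" "c \<notin> dom f"
  shows "y \<in> dom f \<Longrightarrow> (\<And>j. j \<le> i \<Longrightarrow> c \<notin> lev j y) \<Longrightarrow> hit_bound v (f(c \<mapsto> z)) i y = hit_bound v f i y"
proof (induction i arbitrary: y)
  case 0
  then show ?case
    using trace_update[OF assms(1) _ assms(2)] by (simp del: fun_upd_apply)
next
  case (Suc i)
  have y: "y \<in> V" using Suc.prems validD(2)[OF assms(1)] by blast
  have eq: "(if x \<in> dom (f(c \<mapsto> z)) then hit_bound v (f(c \<mapsto> z)) i x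
       else card (lev i x) * q ^ Suc i * ext G v (Suc (Suc i)) (trace (f(c \<mapsto> z)) y))
     = (if x \<in> dom f then hit_bound v f i x
       else card (lev i x) * q ^ Suc i * ext G v (Suc (Suc i)) (trace f y))"
    if x: "x \<in> Ch y" for x
  proof -
    have "x \<noteq> c" using Suc.prems(2)[of "Suc 0"] x by auto
    moreover have "hit_bound v (f(c \<mapsto> z)) i x = hit_bound v f i x" if "x \<in> dom f"
    proof (rule Suc.IH[OF that])
      show "c \<notin> lev j x" if "j \<le> i" for j
        using Suc.prems(2)[of "Suc j"] that x by auto
    qed
    ultimately show ?thesis
      using trace_update[OF assms(1) Suc.prems(1) assms(2)] by simp
  qed
  show ?case unfolding hit_bound.simps by (rule sum.cong[OF refl eq])
qed

text \<open>One averaging step: summing over the next vertex lengthens the counted paths by one arc,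
  and \<open>1 \<le> q * card (free f u)\<close> pays for the uniform choice with one factor
  \<open>q\<close>.\<close>

lemma sum_ext_free_le:
  assumes "valid f" "u \<in> dom f" "1 \<le> q * card (free f u)" "0 \<le> a"
  shows "(\<Sum>z\<in>free f u. a * q ^ i * ext G v l (z # trace f u))
    \<le> card (free f u) * (a * q ^ Suc i * ext G v (Suc l) (trace f u))"
proof -
  have "(\<Sum>z\<in>free f u. ext G v l (z # trace f u)) \<le> ext G v (Suc l) (trace f u)"
    by (rule sum_ext_le[OF free_subset[OF assms(1,2)]])
  then have "(\<Sum>z\<in>free f u. a * q ^ i * ext G v l (z # trace f u))
      \<le> 1 * (a * q ^ i * ext G v (Suc l) (trace f u))"
    using assms(4) q_pos by (auto simp: sum_distrib_left[symmetric] of_nat_sum[symmetric]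
      simp del: of_nat_sum intro!: mult_left_mono)
  also have "\<dots> \<le> (q * card (free f u)) * (a * q ^ i * ext G v (Suc l) (trace f u))"
    using assms q_pos by (intro mult_right_mono) auto
  finally show ?thesis by (simp only: power_Suc mult.assoc mult.left_commute mult.commute)
qed

lemma hit_bound_update_child:
  assumes f: "valid f" and u: "u \<in> dom f" and c: "c \<in> Ch u" "c \<notin> dom f"
  shows "hit_bound v (f(c \<mapsto> z)) i c = card (lev i c) * q ^ i * ext G v (Suc i) (z # trace f u)"
proof -
  have V: "u \<in> V" "c \<in> V" using validD(2)[OF f u] Ch_subset c by auto
  have "Ch c \<inter> dom (f(c \<mapsto> z)) = {}"
    using Ch_not_dom[OF f V(2) c(2)] not_self_Ch[OF V(2)] by auto
  moreover have "trace (f(c \<mapsto> z)) c = z # trace f u"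
    using trace_Ch[OF V(1) c(1), of "f(c \<mapsto> z)"] trace_update[OF f u c(2)] by simp
  ultimately show ?thesis
    using hit_bound_fresh[OF V(2), of "f(c \<mapsto> z)" v i] by (simp only:)
qed

text \<open>The supermartingale property of \<open>hit_bound\<close>. For a child of
  \<open>y\<close> that is already embedded it follows by induction, for \<open>c\<close> from the
  averaging step, and all other children contribute the same as before.\<close>

lemma hit_bound_update_sum:
  assumes f: "valid f" and u: "u \<in> dom f" and c: "c \<in> Ch u" "c \<notin> dom f"
    and q: "1 \<le> q * card (free f u)"
  shows "y \<in> dom f \<Longrightarrow> (\<Sum>z\<in>free f u. hit_bound v (f(c \<mapsto> z)) i y) \<le> card (free f u) * hit_bound v f i y"
proof (induction i arbitrary: y)
  case 0
  then show ?case using trace_update[OF f _ c(2)] by (simp del: fun_upd_apply)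
next
  case (Suc i)
  let ?F = "free f u"
  let ?g = "\<lambda>z x. if x \<in> dom (f(c \<mapsto> z)) then hit_bound v (f(c \<mapsto> z)) i x
       else card (lev i x) * q ^ Suc i * ext G v (Suc (Suc i)) (trace (f(c \<mapsto> z)) y)"
  let ?h = "\<lambda>x. if x \<in> dom f then hit_bound v f i x
       else card (lev i x) * q ^ Suc i * ext G v (Suc (Suc i)) (trace f y)"
  have V: "u \<in> V" "y \<in> V" using validD(2)[OF f] u Suc.prems by auto
  have tr: "trace (f(c \<mapsto> z)) y = trace f y" for z
    using trace_update[OF f Suc.prems c(2)] .
  have "(\<Sum>z\<in>?F. ?g z x) \<le> card ?F * ?h x" if x: "x \<in> Ch y" for x
  proof -
    consider "x \<in> dom f" | "x = c" | "x \<notin> dom f" "x \<noteq> c" by blast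
    then show ?thesis
    proof cases
      case 1
      then show ?thesis using Suc.IH[OF 1] by (simp add: domIff del: fun_upd_apply)
    next
      case 2
      \<comment> \<open>As parents are unique, the old term for \<open>c\<close> was computed from
        the trace of \<open>u\<close>, which is what the averaging step needs.\<close>
      then have "u = y" using par_Ch V x c by metis
      have "(\<Sum>z\<in>?F. ?g z x) = (\<Sum>z\<in>?F. card (lev i c) * q ^ i * ext G v (Suc i) (z # trace f u))"
        unfolding 2 by (intro sum.cong refl) (simp only: hit_bound_update_child[OF f u c] dom_fun_upd, simp)
      also have "\<dots> \<le> card ?F * (card (lev i c) * q ^ Suc i * ext G v (Suc (Suc i)) (trace f u))"
        by (rule sum_ext_free_le[OF f u q]) simp
      finally show ?thesis using 2 c \<open>u = y\<close> by (simp del: power_Suc)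
    next
      case 3
      then show ?thesis by (simp add: tr domIff)
    qed
  qed
  then have "(\<Sum>x\<in>Ch y. \<Sum>z\<in>?F. ?g z x) \<le> (\<Sum>x\<in>Ch y. card ?F * ?h x)"
    by (rule sum_mono)
  then show ?case
    unfolding hit_bound.simps by (subst sum.swap) (simp only: sum_distrib_left)
qed


section \<open>Blocks, depth classes and their product potentials\<close>

definition block_bound :: "'v \<Rightarrow> ('a \<rightharpoonup> 'v) \<Rightarrow> 'a \<Rightarrow> real" where
  "block_bound v f y = (if y \<in> dom f then hit_bound v f (k - 1) y else card (lev (k - 1) y) * C)"

text \<open>The root is excluded because it is already placed when the supermartingale starts;
  vertices of depth less than \<open>k\<close> are counted separately.\<close>

definition depth_class :: "nat \<Rightarrow> 'a set" where
  "depth_class \<rho> = {y \<in> V - {r}. dep y mod k = \<rho>}"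

definition class_potential :: "nat \<Rightarrow> 'v \<Rightarrow> ('a \<rightharpoonup> 'v) \<Rightarrow> real" where
  "class_potential \<rho> v f = (\<Prod>y\<in>depth_class \<rho>. 1 + mu * block_bound v f y)"

lemma finite_depth_class: "finite (depth_class \<rho>)"
  by (simp add: depth_class_def)

lemma block_bound_nonneg: "0 \<le> block_bound v f y"
  using C_nonneg by (simp add: block_bound_def hit_bound_nonneg)

lemma class_potential_nonneg: "v \<in> pverts G \<Longrightarrow> 0 \<le> class_potential \<rho> v f"
  unfolding class_potential_def using mu_nonneg block_bound_nonneg
  by (intro prod_nonneg ballI add_nonneg_nonneg mult_nonneg_nonneg) auto

lemma block_bound_update_other:
  assumes "valid f" "c \<in> V" "c \<notin> dom f" "\<And>j. j < k \<Longrightarrow> c \<notin> lev j y"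
  shows "block_bound v (f(c \<mapsto> z)) y = block_bound v f y"
proof -
  have "y \<noteq> c" using assms(4)[of 0] k_pos by auto
  moreover have "hit_bound v (f(c \<mapsto> z)) (k - 1) y = hit_bound v f (k - 1) y" if "y \<in> dom f"
    using assms(4) k_pos by (intro hit_bound_update_other[OF assms(1,3) that]) auto
  ultimately show ?thesis by (simp add: block_bound_def domIff)
qed

text \<open>When the top \<open>c\<close> of a block is embedded, its bound changes from
  \<open>C\<close> per member to \<open>hit_bound\<close>. A member lies \<open>k - 1\<close> levels
  below \<open>c\<close>, hence \<open>k\<close> steps from \<open>u\<close>, and one more arc leads
  to \<open>v\<close>. So the average is controlled by \<open>q ^ k\<close> times a count of paths
  of length \<open>k + 1\<close>.\<close>

lemma block_bound_start:
  assumes f: "valid f" and u: "u \<in> dom f" and c: "c \<in> Ch u" "c \<notin> dom f"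
    and q: "1 \<le> q * card (free f u)" and v: "v \<in> pverts G"
  shows "(\<Sum>z\<in>free f u. block_bound v (f(c \<mapsto> z)) c) \<le> card (free f u) * block_bound v f c"
proof -
  let ?a = "card (lev (k - 1) c)"
  have "(\<Sum>z\<in>free f u. block_bound v (f(c \<mapsto> z)) c)
      = (\<Sum>z\<in>free f u. ?a * q ^ (k - 1) * ext G v k (z # trace f u))"
    using k_pos by (intro sum.cong refl) (simp add: block_bound_def hit_bound_update_child[OF f u c] del: fun_upd_apply)
  also have "\<dots> \<le> card (free f u) * (?a * q ^ Suc (k - 1) * ext G v (Suc k) (trace f u))"
    by (rule sum_ext_free_le[OF f u q]) simp
  also have "?a * q ^ Suc (k - 1) * ext G v (Suc k) (trace f u) = ?a * (q ^ k * ext G v (Suc k) (trace f u))"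
    using k_pos by (simp del: power_Suc)
  also have "\<dots> \<le> ?a * (q ^ k * num_paths G (Suc k) (the (f u)) v)"
    using ext_trace_le[OF f u, of v "Suc k"] q_pos by (intro mult_left_mono) auto
  also have "\<dots> \<le> ?a * C"
    using num_paths_Suc_k validD(3)[OF f u] v by (intro mult_left_mono) auto
  finally show ?thesis
    using c by (simp add: block_bound_def[of v f c] mult_left_mono del: fun_upd_apply)
qed

text \<open>Embedding \<open>c\<close> affects at most one factor of the product, so averaging the
  product reduces to averaging that factor.\<close>

lemma class_potential_step:
  assumes f: "valid f" and u: "u \<in> dom f" and c: "c \<in> Ch u" "c \<notin> dom f"
    and q: "1 \<le> q * card (free f u)" and v: "v \<in> pverts G"
  shows "(\<Sum>z\<in>free f u. class_potential \<rho> v (f(c \<mapsto> z))) \<le> card (free f u) * class_potential \<rho> v f"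
proof -
  have uV: "u \<in> V" using validD(2)[OF f u] .
  then have cV: "c \<in> V" using Ch_subset c by auto
  show ?thesis
  proof (cases "\<exists>y\<in>depth_class \<rho>. \<exists>j<k. c \<in> lev j y")
    case False
    then have "class_potential \<rho> v (f(c \<mapsto> z)) = class_potential \<rho> v f" for z
      unfolding class_potential_def using block_bound_update_other[OF f cV c(2)] by (intro prod.cong refl) (metis (no_types))
    then show ?thesis by simp
  next
    case True
    then obtain y0 j where y0: "y0 \<in> depth_class \<rho>" "j < k" "c \<in> lev j y0" by blast
    have y0V: "y0 \<in> V" "y0 \<noteq> r" using y0 by (auto simp: depth_class_def)
    have dep_c: "dep c = dep y0 + j" using lev_dep[OF y0V(1) y0(3)] .
    \<comment> \<open>Two tops in the same class have depths congruent modulo \<open>k\<close>. Both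
      offsets to \<open>c\<close> are below \<open>k\<close>, so they agree, and the top is the same
      iterated parent of \<open>c\<close>.\<close>
    have unaffected: "block_bound v (f(c \<mapsto> z)) y = block_bound v f y" if y: "y \<in> depth_class \<rho>" "y \<noteq> y0" for y z
    proof (rule block_bound_update_other[OF f cV c(2)])
      fix i assume "i < k"
      show "c \<notin> lev i y"
      proof
        assume ci: "c \<in> lev i y"
        have yV: "y \<in> V" "dep y mod k = dep y0 mod k" using y y0 by (auto simp: depth_class_def)
        have "dep y + i = dep y0 + j" using lev_dep[OF yV(1) ci] dep_c by simp
        then have "i mod k = j mod k"
          by (rule mod_add_left_imp_eq[OF yV(2)])
        then have "i = j" using \<open>i < k\<close> y0 by simp
        then show False using lev_par[OF yV(1) ci] lev_par[OF y0V(1) y0(3)] y by simp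
      qed
    qed
    have "(\<Sum>z\<in>free f u. block_bound v (f(c \<mapsto> z)) y0) \<le> card (free f u) * block_bound v f y0"
    \<comment> \<open>Either \<open>c\<close> is the top and the block starts now, or
      \<open>y0\<close> is on the root path of the embedded vertex \<open>u\<close> and hence
      already embedded.\<close>
    proof (cases j)
      case 0
      then show ?thesis using block_bound_start[OF f u c q v] y0 by simp
    next
      case (Suc i)
      have "dep u = dep y0 + i" using dep_c dep_Ch[OF uV c(1)] Suc by simp
      moreover have "y0 = (par ^^ i) u"
        using lev_par[OF y0V(1) y0(3)] par_Ch[OF uV c(1)] Suc by (simp add: funpow_swap1)
      ultimately have "y0 \<in> dom f" using funpow_par_in_anc[of i u] anc_dom[OF f u] by auto
      moreover from this have "y0 \<noteq> c" using c by auto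
      ultimately show ?thesis
        using hit_bound_update_sum[OF f u c q, of y0 v "k - 1"] by (simp add: block_bound_def domIff)
    qed
    then have "(\<Sum>z\<in>free f u. 1 + mu * block_bound v (f(c \<mapsto> z)) y0) \<le> card (free f u) * (1 + mu * block_bound v f y0)"
      using mult_left_mono[OF _ mu_nonneg[OF v]]
      by (simp add: sum.distrib sum_distrib_left[symmetric] ring_distribs mult.left_commute[of _ mu]
          del: fun_upd_apply)
    then show ?thesis
      unfolding class_potential_def using y0(1) unaffected mu_nonneg[OF v] block_bound_nonneg
      by (intro sum_prod_one_factor[OF finite_depth_class]) auto
  qed
qed

section \<open>Hits: embedded neighbors of \<open>v\<close> whose branch has avoided
  \<open>v\<close>\<close>

definition hit :: "'v \<Rightarrow> ('a \<rightharpoonup> 'v) \<Rightarrow> 'a \<Rightarrow> real" where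
  "hit v f x = (if x \<in> dom f then ext G v (Suc 0) (trace f x) else 0)"

lemma hit_nonneg: "0 \<le> hit v f x"
  by (simp add: hit_def)

lemma sum_hit_not_dom: "valid f \<Longrightarrow> y \<in> V \<Longrightarrow> y \<notin> dom f \<Longrightarrow> sum (hit v f) (lev i y) = 0"
  using lev_not_dom[of f y i] by (intro sum.neutral) (auto simp: hit_def)

lemma sum_hit_le_hit_bound:
  assumes "valid f"
  shows "y \<in> dom f \<Longrightarrow> sum (hit v f) (lev i y) \<le> hit_bound v f i y"
proof (induction i arbitrary: y)
  case (Suc i)
  have y: "y \<in> V" using validD(2)[OF assms Suc.prems] .
  have "sum (hit v f) (lev i c) \<le> (if c \<in> dom f then hit_bound v f i c
     else card (lev i c) * q ^ Suc i * ext G v (Suc (Suc i)) (trace f y))" if "c \<in> Ch y" for c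
    using Suc.IH[of c] sum_hit_not_dom[OF assms, of c v i] that Ch_subset[OF y] q_pos
    by (cases "c \<in> dom f") (auto simp del: power_Suc)
  then show ?case
    unfolding sum_lev_Suc[OF y] hit_bound.simps by (rule sum_mono)
qed (simp add: hit_def)

text \<open>A deterministic bound: by injectivity the embedded children of \<open>y\<close> have
  distinct images off the trace of \<open>y\<close>, so different hits give different paths to
  \<open>v\<close>.\<close>

lemma sum_hit_le_ext:
  assumes "valid f"
  shows "y \<in> dom f \<Longrightarrow> sum (hit v f) (lev i y) \<le> ext G v (Suc i) (trace f y)"
proof (induction i arbitrary: y)
  case (Suc i)
  have y: "y \<in> V" using validD(2)[OF assms Suc.prems] .
  let ?A = "Ch y \<inter> dom f" and ?g = "\<lambda>c. the (f c)"
  have "sum (hit v f) (lev (Suc i) y) = (\<Sum>c\<in>?A. sum (hit v f) (lev i c))"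
    unfolding sum_lev_Suc[OF y] using Ch_subset[OF y] finite_Ch[OF y]
    by (intro sum.mono_neutral_right ballI sum_hit_not_dom[OF assms]) auto
  also have "\<dots> \<le> (\<Sum>c\<in>?A. ext G v (Suc i) (?g c # trace f y))"
    using Suc.IH trace_Ch[OF y, of _ f] unfolding of_nat_sum by (intro sum_mono) fastforce
  also have "\<dots> = (\<Sum>z\<in>?g ` ?A. ext G v (Suc i) (z # trace f y))"
    using valid_inj[OF assms] by (subst sum.reindex) (auto simp: inj_on_def)
  also have "\<dots> \<le> ext G v (Suc (Suc i)) (trace f y)"
  proof -
    have "the (f c) \<in> nbrs G (the (f y)) - set (trace f y)" if c: "c \<in> ?A" for c
      using validD(6)[OF assms y] distinct_trace[OF assms, of c] trace_Ch[OF y, of c f] c by auto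
    then have "?g ` ?A \<subseteq> nbrs G (hd (trace f y)) - set (trace f y)" by auto
    from sum_ext_le[OF this] show ?thesis by (simp flip: of_nat_sum)
  qed
  finally show ?case .
qed (simp add: hit_def)

lemma sum_hit_le_num_paths:
  assumes "valid f" "y \<in> dom f"
  shows "sum (hit v f) (lev i y) \<le> num_paths G (Suc i) (the (f y)) v"
  using sum_hit_le_ext[OF assms, of v i] ext_trace_le[OF assms, of v "Suc i"] by linarith

text \<open>As no child of \<open>u\<close> is embedded, the branch of an embedded vertex other than
  \<open>u\<close> cannot pass through \<open>u\<close>. Every occupied neighbor therefore counts as
  a hit.\<close>

lemma occupied_le_sum_hit:
  assumes f: "valid f" and u: "u \<in> dom f" "Ch u \<inter> dom f = {}"
  shows "card (nbrs G (the (f u)) \<inter> ran f) \<le> sum (hit (the (f u)) f) V"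
proof -
  let ?v = "the (f u)"
  let ?X = "{x \<in> dom f. the (f x) \<in> nbrs G ?v}"
  have sub: "dom f \<subseteq> V" using validD(2)[OF f] by blast
  have "hit ?v f x = 1" if x: "x \<in> ?X" for x
  proof -
    have "u \<notin> set (anc x)"
    proof
      assume "u \<in> set (anc x)"
      then obtain i where i: "u = (par ^^ i) x" "i \<le> dep x"
        by (auto simp: anc_def less_Suc_eq_le simp del: upt_Suc)
      \<comment> \<open>A vertex is not its own neighbor, so \<open>u\<close> would be a proper
        ancestor of \<open>x\<close>; the vertex just below \<open>u\<close> on this root path is
        then an embedded child of \<open>u\<close>.\<close>
      have "x \<noteq> u" using x by auto
      then obtain j where j: "i = Suc j" using i by (cases i) auto
      let ?y = "(par ^^ j) x"
      have y: "?y \<in> V" "x \<in> lev j ?y" using funpow_par[of x j] x sub i j by auto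
      have "dep ?y > 0" using lev_dep[OF y] i j by simp
      then have "?y \<noteq> r" by (intro notI) simp
      then have "?y \<in> Ch u" using in_Ch_par[OF y(1)] i j by simp
      moreover have "?y \<in> dom f"
        using funpow_par_in_anc[of j x] anc_dom[OF f, of x] x i j by auto
      ultimately show False using u(2) by blast
    qed
    then have "?v \<notin> set (trace f x)"
      using anc_dom[OF f, of x] valid_inj[OF f u(1)] x by (force simp: trace_def)
    moreover have "?v \<in> nbrs G (the (f x))" using x nbrs_sym by auto
    ultimately show ?thesis using x by (simp add: hit_def ext_1)
  qed
  then have "real (card ?X) = sum (hit ?v f) ?X" by simp
  also have "\<dots> \<le> sum (hit ?v f) V"
    using sub hit_nonneg by (intro sum_mono2) auto
  finally have "real (card ?X) \<le> sum (hit ?v f) V" .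
  moreover have "nbrs G ?v \<inter> ran f \<subseteq> (\<lambda>x. the (f x)) ` ?X"
    by (force simp: ran_def)
  then have "card (nbrs G ?v \<inter> ran f) \<le> card ?X"
    using sub finite_subset[OF sub] by (intro surj_card_le) auto
  ultimately show ?thesis by linarith
qed

text \<open>Each of the \<open>k\<close> shallow levels is a level below the root and has at most
  \<open>B\<^sub>0\<close> hits. A deeper vertex is charged to the block of its ancestor
  \<open>k - 1\<close> levels up, which is not the root.\<close>

lemma sum_hit_split:
  assumes f: "valid f" and v: "v \<in> pverts G"
  shows "sum (hit v f) V \<le> k * B\<^sub>0 + (\<Sum>\<rho><k. \<Sum>y\<in>depth_class \<rho>. sum (hit v f) (lev (k - 1) y))"
proof -
  let ?S = "{x \<in> V. dep x < k}" and ?T = "{x \<in> V. k \<le> dep x}"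
  have "sum (hit v f) V = sum (hit v f) ?S + sum (hit v f) ?T"
    by (subst sum.union_disjoint[symmetric]) (auto intro!: sum.cong)
  moreover have "sum (hit v f) ?S \<le> k * B\<^sub>0"
  proof -
    have "sum (hit v f) ?S = (\<Sum>j<k. sum (hit v f) {x \<in> ?S. dep x = j})"
      by (rule sum.group[symmetric]) auto
    also have "\<dots> \<le> (\<Sum>j<k. B\<^sub>0)"
    proof (rule sum_mono)
      fix j assume j: "j \<in> {..<k}"
      have "x \<in> lev (dep x) r" if "x \<in> V" for x
      proof -
        let ?y = "(par ^^ dep x) x"
        have y: "?y \<in> V" "x \<in> lev (dep x) ?y" using funpow_par[OF that, of "dep x"] by auto
        then have "dep ?y = 0" using lev_dep[OF y] by simp
        then have "?y = r" using dep_pos[OF y(1)] by auto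
        then show ?thesis using y by simp
      qed
      then have "sum (hit v f) {x \<in> ?S. dep x = j} \<le> sum (hit v f) (lev j r)"
        using hit_nonneg by (intro sum_mono2 finite_lev) auto
      also have "\<dots> \<le> B\<^sub>0"
        using sum_hit_le_num_paths[OF f validD(1)[OF f], of v j]
          num_paths_le[OF validD(3)[OF f validD(1)[OF f]] v, of j] j by simp
      finally show "sum (hit v f) {x \<in> ?S. dep x = j} \<le> B\<^sub>0" .
    qed
    finally show ?thesis by simp
  qed
  moreover have "sum (hit v f) ?T \<le> (\<Sum>\<rho><k. \<Sum>y\<in>depth_class \<rho>. sum (hit v f) (lev (k - 1) y))"
  proof -
    let ?p = "\<lambda>x. (par ^^ (k - 1)) x"
    have p: "?p x \<in> V - {r} \<and> x \<in> lev (k - 1) (?p x)" if "x \<in> ?T" for x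
    proof -
      have y: "?p x \<in> V" "x \<in> lev (k - 1) (?p x)"
        using funpow_par[of x "k - 1"] that by auto
      have "dep (?p x) > 0" using lev_dep[OF y] that k_pos by auto
      then have "?p x \<noteq> r" by (intro notI) simp
      then show ?thesis using y by simp
    qed
    have "sum (hit v f) ?T = (\<Sum>y\<in>V - {r}. sum (hit v f) {x \<in> ?T. ?p x = y})"
      by (rule sum.group[symmetric]) (use p in auto)
    also have "\<dots> \<le> (\<Sum>y\<in>V - {r}. sum (hit v f) (lev (k - 1) y))"
      using p hit_nonneg finite_lev by (intro sum_mono sum_mono2) auto
    also have "\<dots> = (\<Sum>\<rho><k. \<Sum>y\<in>{y \<in> V - {r}. dep y mod k = \<rho>}. sum (hit v f) (lev (k - 1) y))"
      by (rule sum.group[symmetric]) (use k_pos in auto)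
    finally show ?thesis by (simp only: depth_class_def)
  qed
  ultimately show ?thesis by linarith
qed

text \<open>The exponential factors over blocks. An embedded top has at most \<open>B\<close> hits
  in its block, so the linear bound applies; a block whose top is not embedded has no hits
  yet.\<close>

lemma exp_sum_hit_le_class_potential:
  assumes f: "valid f" and v: "v \<in> pverts G"
  shows "exp (lam * (\<Sum>y\<in>depth_class \<rho>. sum (hit v f) (lev (k - 1) y))) \<le> class_potential \<rho> v f"
proof -
  have "exp (lam * sum (hit v f) (lev (k - 1) y)) \<le> 1 + mu * block_bound v f y" if y: "y \<in> depth_class \<rho>" for y
  proof (cases "y \<in> dom f")
    case True
    have "sum (hit v f) (lev (k - 1) y) \<le> B"
      using sum_hit_le_num_paths[OF f True, of v "k - 1"] num_paths_k[OF validD(3)[OF f True] v] k_pos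
      by simp
    then have "exp (lam * sum (hit v f) (lev (k - 1) y)) \<le> 1 + mu * sum (hit v f) (lev (k - 1) y)"
      unfolding mu_def using lam_nonneg lam_B hit_nonneg by (intro exp_le_linear sum_nonneg) auto
    also have "\<dots> \<le> 1 + mu * block_bound v f y"
      using sum_hit_le_hit_bound[OF f True] mu_nonneg[OF v] True by (simp add: block_bound_def mult_left_mono)
    finally show ?thesis .
  next
    case False
    then show ?thesis
      using y sum_hit_not_dom[OF f, of y] mu_nonneg[OF v] block_bound_nonneg by (simp add: depth_class_def)
  qed
  then show ?thesis
    unfolding class_potential_def sum_distrib_left exp_sum[OF finite_depth_class] by (intro prod_mono) auto
qed

section \<open>The total potential, its threshold and its initial value\<close>

definition size_depth_class :: "nat \<Rightarrow> nat" where
  "size_depth_class \<rho> = (\<Sum>y\<in>depth_class \<rho>. card (lev (k - 1) y))"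

lemma sum_size_depth_class: "(\<Sum>\<rho><k. size_depth_class \<rho>) \<le> card V"
proof -
  have "(\<Sum>\<rho><k. size_depth_class \<rho>) = (\<Sum>y\<in>V - {r}. card (lev (k - 1) y))"
    unfolding size_depth_class_def depth_class_def by (rule sum.group) (use k_pos in auto)
  also have "\<dots> = card (\<Union>y\<in>V - {r}. lev (k - 1) y)"
    by (rule card_UN_disjoint[symmetric]) (auto simp: finite_lev lev_disjoint)
  also have "\<dots> \<le> card V"
    using lev_subset by (intro card_mono) auto
  finally show ?thesis .
qed

text \<open>A union bound over all vertices and classes. The normalization makes a summand at least
  1 as soon as a class exceeds \<open>C * size_depth_class \<rho> + s\<close> hits.\<close>

definition potential :: "('a \<rightharpoonup> 'v) \<Rightarrow> real" where
  "potential f = (\<Sum>v\<in>pverts G. \<Sum>\<rho><k. class_potential \<rho> v f * exp (- lam * (C * size_depth_class \<rho> + s)))"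

lemma potential_nonneg: "0 \<le> potential f"
  unfolding potential_def by (intro sum_nonneg mult_nonneg_nonneg class_potential_nonneg) auto

lemma potential_step:
  assumes "valid f" "u \<in> dom f" "c \<in> Ch u" "c \<notin> dom f" "1 \<le> q * card (free f u)"
  shows "(\<Sum>z\<in>free f u. potential (f(c \<mapsto> z))) \<le> card (free f u) * potential f"
proof -
  let ?e = "\<lambda>\<rho>. exp (- lam * (C * size_depth_class \<rho> + s))"
  have "(\<Sum>z\<in>free f u. potential (f(c \<mapsto> z)))
      = (\<Sum>v\<in>pverts G. \<Sum>\<rho><k. (\<Sum>z\<in>free f u. class_potential \<rho> v (f(c \<mapsto> z))) * ?e \<rho>)"
    unfolding potential_def sum_distrib_right
    by (subst sum.swap, intro sum.cong refl, subst sum.swap) simp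
  also have "\<dots> \<le> (\<Sum>v\<in>pverts G. \<Sum>\<rho><k. card (free f u) * class_potential \<rho> v f * ?e \<rho>)"
    by (intro sum_mono mult_right_mono class_potential_step[OF assms]) auto
  also have "\<dots> = card (free f u) * potential f"
    unfolding potential_def sum_distrib_left by (simp add: mult.assoc)
  finally show ?thesis .
qed

text \<open>With the potential below 1, no class at \<open>the (f u)\<close> exceeds its threshold.
  Adding the thresholds of all \<open>k\<close> classes uses that the blocks are disjoint.\<close>

lemma occupied_le:
  assumes f: "valid f" and u: "u \<in> dom f" "Ch u \<inter> dom f = {}" and "potential f < 1"
  shows "card (nbrs G (the (f u)) \<inter> ran f) \<le> k * B\<^sub>0 + C * card V + k * s"
proof -
  let ?v = "the (f u)"
  let ?S = "\<lambda>\<rho>. \<Sum>y\<in>depth_class \<rho>. sum (hit ?v f) (lev (k - 1) y)"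
  have v: "?v \<in> pverts G" using validD(3)[OF f u(1)] .
  have "?S \<rho> \<le> C * size_depth_class \<rho> + s" if \<rho>: "\<rho> < k" for \<rho>
  proof (rule ccontr)
    let ?t = "C * size_depth_class \<rho> + s"
    assume "\<not> ?S \<rho> \<le> ?t"
    then have "exp (lam * ?t) \<le> exp (lam * ?S \<rho>)"
      using lam_nonneg by (simp add: mult_left_mono)
    also have "\<dots> \<le> class_potential \<rho> ?v f" by (rule exp_sum_hit_le_class_potential[OF f v])
    finally have "exp (lam * ?t) * exp (- lam * ?t) \<le> class_potential \<rho> ?v f * exp (- lam * ?t)"
      by (rule mult_right_mono) simp
    then have "1 \<le> class_potential \<rho> ?v f * exp (- lam * ?t)"
      by (simp flip: exp_add)
    also have "\<dots> \<le> (\<Sum>\<rho><k. class_potential \<rho> ?v f * exp (- lam * (C * size_depth_class \<rho> + s)))"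
      using \<rho> class_potential_nonneg[OF v] by (intro member_le_sum) auto
    also have "\<dots> \<le> potential f"
      unfolding potential_def using v class_potential_nonneg pair_finite_verts
      by (intro member_le_sum[of ?v "pverts G" "\<lambda>v. \<Sum>\<rho><k. class_potential \<rho> v f * exp (- lam * (C * size_depth_class \<rho> + s))"])
         (auto intro!: sum_nonneg)
    finally show False using \<open>potential f < 1\<close> by simp
  qed
  then have "(\<Sum>\<rho><k. ?S \<rho>) \<le> (\<Sum>\<rho><k. C * size_depth_class \<rho> + s)"
    by (intro sum_mono) auto
  also have "\<dots> = C * (\<Sum>\<rho><k. size_depth_class \<rho>) + k * s"
    by (simp add: sum.distrib sum_distrib_left)
  also have "\<dots> \<le> C * card V + k * s"
    using sum_size_depth_class C_nonneg by (intro add_right_mono mult_left_mono) (auto simp flip: of_nat_sum)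
  finally show ?thesis
    using occupied_le_sum_hit[OF f u] sum_hit_split[OF f v] by linarith
qed

lemma valid_root: "z \<in> pverts G \<Longrightarrow> valid [r \<mapsto> z]"
  using root_not_Ch by (auto simp: valid_def)

text \<open>Initially no top of a block is embedded, so every factor is explicit. The bound is
  independent of \<open>z\<close>, which makes the random walk irrelevant.\<close>

lemma potential_root:
  assumes "s \<ge> 0"
  shows "potential [r \<mapsto> z] \<le> card (pverts G) * k * exp (lam * (lam * B * (C * card V) - s))"
proof -
  have "class_potential \<rho> v [r \<mapsto> z] * exp (- lam * (C * size_depth_class \<rho> + s)) \<le> exp (lam * (lam * B * (C * card V) - s))"
    if v: "v \<in> pverts G" and \<rho>: "\<rho> < k" for \<rho> v
  proof -
    have "class_potential \<rho> v [r \<mapsto> z] = (\<Prod>y\<in>depth_class \<rho>. 1 + mu * (card (lev (k - 1) y) * C))"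
      unfolding class_potential_def by (intro prod.cong refl) (auto simp: block_bound_def depth_class_def)
    also have "\<dots> \<le> (\<Prod>y\<in>depth_class \<rho>. exp (mu * (card (lev (k - 1) y) * C)))"
      using mu_nonneg[OF v] C_nonneg by (intro prod_mono) auto
    also have "\<dots> = exp (mu * (C * size_depth_class \<rho>))"
      by (simp add: exp_sum[OF finite_depth_class, symmetric] size_depth_class_def sum_distrib_left mult_ac)
    finally have "class_potential \<rho> v [r \<mapsto> z] * exp (- lam * (C * size_depth_class \<rho> + s))
        \<le> exp (mu * (C * size_depth_class \<rho>)) * exp (- lam * (C * size_depth_class \<rho> + s))"
      by (rule mult_right_mono) simp
    \<comment> \<open>The linear parts cancel, since
      \<open>mu - lam = lam * lam * B\<close>.\<close>
    also have "\<dots> = exp (lam * (lam * B * (C * size_depth_class \<rho>) - s))"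
      by (simp add: mu_def algebra_simps flip: exp_add)
    also have "\<dots> \<le> exp (lam * (lam * B * (C * card V) - s))"
    proof -
      have "size_depth_class \<rho> \<le> (\<Sum>\<rho><k. size_depth_class \<rho>)" using \<rho> by (intro member_le_sum) auto
      then have "size_depth_class \<rho> \<le> card V" using sum_size_depth_class by linarith
      then show ?thesis
        using lam_nonneg B_nonneg[OF v] C_nonneg
        by (auto intro!: mult_left_mono diff_right_mono)
    qed
    finally show ?thesis .
  qed
  then have "potential [r \<mapsto> z] \<le> (\<Sum>v\<in>pverts G. \<Sum>\<rho><k. exp (lam * (lam * B * (C * card V) - s)))"
    unfolding potential_def by (intro sum_mono) auto
  then show ?thesis by simp
qed

end

section \<open>The failure probability\<close>

context tree_embedding
begin

text \<open>The assumption on \<open>q\<close> refers to the last child: when it is placed,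
  \<open>length cs - 1\<close> of the initially free neighbors have been taken by its
  siblings.\<close>

lemma embed_children_potential:
  assumes "valid f" "u \<in> dom f" "set cs \<subseteq> Ch u" "distinct cs" "set cs \<inter> dom f = {}"
    and "cs \<noteq> [] \<Longrightarrow> 1 \<le> q * (real (card (free f u)) + 1 - length cs)"
  shows "(\<integral>\<^sup>+g. ennreal (potential g) \<partial>embed_children G (the (f u)) cs f) \<le> ennreal (potential f)"
    and "g \<in> set_pmf (embed_children G (the (f u)) cs f) \<Longrightarrow> valid g"
proof -
  have "(\<integral>\<^sup>+g. ennreal (potential g) \<partial>embed_children G (the (f u)) cs f) \<le> ennreal (potential f) \<and>
    (\<forall>g\<in>set_pmf (embed_children G (the (f u)) cs f). valid g)"
    using assms
  proof (induction cs arbitrary: f)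
    case Nil
    then show ?case by simp
  next
    case (Cons c cs)
    note f = Cons.prems(1) and u = Cons.prems(2)
    let ?F = "free f u"
    have c: "c \<in> Ch u" "c \<notin> dom f" using Cons.prems by auto
    have "c \<noteq> u" using c u by auto
    have q: "1 \<le> q * (real (card ?F) - length cs)" using Cons.prems(6) by simp
    also have "\<dots> \<le> q * card ?F" using q_pos by (intro mult_left_mono) auto
    finally have qF: "1 \<le> q * card ?F" .
    then have "card ?F \<noteq> 0" by (intro notI) simp
    then have F: "?F \<noteq> {}" "finite ?F" by (auto simp del: Diff_eq_empty_iff)
    have IH: "(\<integral>\<^sup>+g. ennreal (potential g) \<partial>embed_children G (the (f u)) cs (f(c \<mapsto> z))) \<le> ennreal (potential (f(c \<mapsto> z))) \<and>
      (\<forall>g\<in>set_pmf (embed_children G (the (f u)) cs (f(c \<mapsto> z))). valid g)" if z: "z \<in> ?F" for z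
    proof -
      have "free (f(c \<mapsto> z)) u = ?F - {z}"
        using c \<open>c \<noteq> u\<close> by (auto simp: ran_map_upd domIff)
      then have "real (card (free (f(c \<mapsto> z)) u)) = real (card ?F) - 1"
        using z F by (simp add: card_Diff_singleton of_nat_diff Suc_leI card_gt_0_iff)
      then have "1 \<le> q * (real (card (free (f(c \<mapsto> z)) u)) + 1 - length cs)" using q by simp
      then show ?thesis
        using Cons.IH[OF valid_update[OF f u c z]] Cons.prems \<open>c \<noteq> u\<close> fun_upd_other[of u c f "Some z"]
        by (simp del: fun_upd_apply)
    qed
    have "(\<integral>\<^sup>+g. ennreal (potential g) \<partial>embed_children G (the (f u)) (c # cs) f)
        = (\<integral>\<^sup>+z. \<integral>\<^sup>+g. ennreal (potential g) \<partial>embed_children G (the (f u)) cs (f(c \<mapsto> z)) \<partial>pmf_of_set ?F)"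
      by simp
    also have "\<dots> \<le> (\<integral>\<^sup>+z. ennreal (potential (f(c \<mapsto> z))) \<partial>pmf_of_set ?F)"
      using IH F by (intro nn_integral_mono_AE) (auto simp: AE_measure_pmf_iff)
    also have "\<dots> = ennreal ((\<Sum>z\<in>?F. potential (f(c \<mapsto> z))) / card ?F)"
      using F potential_nonneg \<open>card ?F \<noteq> 0\<close>
      by (subst divide_ennreal[symmetric])
         (auto simp: nn_integral_pmf_of_set sum_ennreal ennreal_of_nat_eq_real_of_nat
            simp del: fun_upd_apply intro!: sum_nonneg)
    also have "\<dots> \<le> ennreal (potential f)"
      using potential_step[OF f u c qF] \<open>card ?F \<noteq> 0\<close>
      by (intro ennreal_leI) (simp add: divide_simps mult.commute del: fun_upd_apply)
    finally show ?case using IH F by auto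
  qed
  then show "(\<integral>\<^sup>+g. ennreal (potential g) \<partial>embed_children G (the (f u)) cs f) \<le> ennreal (potential f)"
    and "g \<in> set_pmf (embed_children G (the (f u)) cs f) \<Longrightarrow> valid g" by auto
qed

text \<open>Induction over the run, whatever choices are made. Where the potential is at least 1 the
  claim is trivial. Below 1, \<open>occupied_le\<close> leaves enough free neighbors, so the run
  cannot fail here and the potential does not increase on average.\<close>

lemma run_law_potential:
  fixes d D :: real
  assumes run: "run_law T G r f p" and f: "valid f"
    and T: "children T r = Ch" "pverts T = V"
    and deg: "\<And>v. v \<in> pverts G \<Longrightarrow> d \<le> card (nbrs G v)"
    and D: "\<And>u. u \<in> V \<Longrightarrow> card (Ch u) \<le> D"
    and q: "1 \<le> q * (d - (k * B\<^sub>0 + C * card V + k * s) - D)"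
  shows "emeasure (measure_pmf p) (- Some ` {g. valid g \<and> V \<subseteq> dom g}) \<le> ennreal (potential f)"
proof -
  have trivial: "emeasure (measure_pmf p) X \<le> ennreal (potential f)" if "1 \<le> potential f"
    for p f and X :: "('a \<rightharpoonup> 'v) option set"
    using order_trans[OF measure_pmf.emeasure_le_1, of "ennreal (potential f)"] ennreal_leI[OF that] by simp
  show ?thesis
    using run f
  proof (induction rule: run_law.induct)
    case (finished f)
    then show ?case using T by auto
  next
    case (failed u f)
    have u: "u \<in> dom f" "u \<in> V" "the (f u) \<in> pverts G"
      using failed.hyps(1) validD(2,3)[OF failed.prems] by blast+
    have "1 \<le> potential f"
    proof (rule ccontr)
      assume "\<not> 1 \<le> potential f"
      then have "real (card (nbrs G (the (f u)) \<inter> ran f)) \<le> k * B\<^sub>0 + C * card V + k * s"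
        using failed T by (intro occupied_le) auto
      moreover have "card (nbrs G (the (f u))) = card (nbrs G (the (f u)) \<inter> ran f) + card (free f u)"
        by (subst card_Un_disjoint[symmetric]) (auto intro!: arg_cong[where f = card])
      \<comment> \<open>Since \<open>q\<close> is positive, the assumption leaves room for more than
        \<open>D\<close> vertices, contradicting the failure.\<close>
      moreover have "0 < d - (k * B\<^sub>0 + C * card V + k * s) - D"
        using q q_pos by (metis less_le_trans zero_less_mult_pos zero_less_one)
      ultimately show False
        using failed(4) deg[OF u(3)] D[OF u(2)] T by simp
    qed
    then show ?case by (rule trivial)
  next
    case (step u f cs D')
    show ?case
    proof (cases "1 \<le> potential f")
      case True
      then show ?thesis by (rule trivial)
    next
      case False
      have u: "u \<in> dom f" "u \<in> V" "the (f u) \<in> pverts G"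
        using step.hyps(1) validD(2,3)[OF step.prems] by blast+
      have "real (card (nbrs G (the (f u)) \<inter> ran f)) \<le> k * B\<^sub>0 + C * card V + k * s"
        using False step T by (intro occupied_le) auto
      moreover have "card (nbrs G (the (f u))) = card (nbrs G (the (f u)) \<inter> ran f) + card (free f u)"
        by (subst card_Un_disjoint[symmetric]) (auto intro!: arg_cong[where f = card])
      moreover have "real (length cs) \<le> D"
        using D[OF u(2)] step T by (metis distinct_card)
      ultimately have "d - (k * B\<^sub>0 + C * card V + k * s) - D \<le> real (card (free f u)) + 1 - length cs"
        using deg[OF u(3)] by simp
      then have "q * (d - (k * B\<^sub>0 + C * card V + k * s) - D) \<le> q * (real (card (free f u)) + 1 - length cs)"
        using q_pos by (intro mult_left_mono) auto
      then have "1 \<le> q * (real (card (free f u)) + 1 - length cs)"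
        using q by linarith
      note * = embed_children_potential[OF step.prems u(1), of cs, OF _ \<open>distinct cs\<close> _ this]
      let ?bad = "- Some ` {g. valid g \<and> V \<subseteq> dom g}"
      have "emeasure (measure_pmf (bind_pmf (embed_children G (the (f u)) cs f) D')) ?bad
          = (\<integral>\<^sup>+g. emeasure (measure_pmf (D' g)) ?bad \<partial>embed_children G (the (f u)) cs f)"
        by simp
      also have "\<dots> \<le> (\<integral>\<^sup>+g. ennreal (potential g) \<partial>embed_children G (the (f u)) cs f)"
        using step *(2) T by (intro nn_integral_mono_AE) (auto simp: AE_measure_pmf_iff)
      also have "\<dots> \<le> ennreal (potential f)"
        using *(1) step T by auto
      finally show ?thesis .
    qed
  qed
qed

end

section \<open>Bounds on shorter paths and the law of the whole algorithm\<close>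

context pair_graph
begin

text \<open>Double counting of pairs of a path \<open>p\<close> from \<open>u\<close> to
  \<open>v\<close> and a neighbor \<open>w\<close> of \<open>u\<close> off \<open>p\<close>:
  prepending \<open>w\<close> gives a path one arc longer.\<close>

lemma num_paths_extend:
  fixes d M :: real
  assumes deg: "d \<le> card (nbrs G u)" and j: "j < d"
    and M: "\<And>w. w \<in> nbrs G u \<Longrightarrow> num_paths G (Suc j) w v \<le> M"
  shows "num_paths G j u v \<le> M * (d / (d - j))"
proof -
  let ?N = "nbrs G u" and ?A = "{p. apath u p v \<and> length p = j}"
  let ?R = "\<lambda>p w. w \<notin> set (pawalk_verts u p)"
  let ?c = "real (card ?N)"
  have M0: "0 \<le> M"
  proof -
    have "?N \<noteq> {}" 
      using deg j
      by (metis card.empty not_less of_nat_0 of_nat_0_le_iff order_le_less_trans order_less_le_trans)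
    then show ?thesis using M by (meson all_not_in_conv of_nat_0_le_iff order_trans)
  qed
  have free: "?c - j \<le> card {w \<in> ?N. ?R p w}" if "p \<in> ?A" for p
  proof -
    have hd: "pawalk_verts u p = u # tl (pawalk_verts u p)"
      using that by (cases p) (auto simp: apath_Cons_iff)
    \<comment> \<open>The start \<open>u\<close> is not its own neighbor, so a path of length
      \<open>j\<close> blocks at most \<open>j\<close> of its neighbors.\<close>
    then have "?N \<inter> set (pawalk_verts u p) \<subseteq> set (tl (pawalk_verts u p))"
      using not_in_own_nbrs by (metis IntE set_ConsD subsetI)
    then have "card (?N \<inter> set (pawalk_verts u p)) \<le> length (tl (pawalk_verts u p))"
      by (meson List.finite_set card_length card_mono order_trans)
    then have "card (?N \<inter> set (pawalk_verts u p)) \<le> j"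
      using that length_awalk_verts[of u p] by simp
    moreover have "card ?N = card (?N \<inter> set (pawalk_verts u p)) + card {w \<in> ?N. ?R p w}"
      by (subst card_Un_disjoint[symmetric]) (auto intro!: arg_cong[where f = card])
    ultimately show ?thesis by linarith
  qed
  have "num_paths G j u v * (?c - j) = (\<Sum>p\<in>?A. ?c - j)"
    by (simp add: num_paths_def)
  also have "\<dots> \<le> (\<Sum>p\<in>?A. real (card {w \<in> ?N. ?R p w}))"
    by (rule sum_mono[OF free])
  also have "\<dots> = (\<Sum>p\<in>?A. \<Sum>w\<in>?N. if ?R p w then 1 else 0)"
    by (intro sum.cong refl) (simp add: sum.inter_filter[symmetric])
  also have "\<dots> = (\<Sum>w\<in>?N. \<Sum>p\<in>?A. if ?R p w then 1 else 0)"
    by (rule sum.swap)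
  also have "\<dots> = (\<Sum>w\<in>?N. real (card {p \<in> ?A. ?R p w}))"
    by (intro sum.cong refl) (simp add: sum.inter_filter[symmetric])
  also have "\<dots> \<le> (\<Sum>w\<in>?N. M)"
  proof (rule sum_mono)
    fix w assume w: "w \<in> ?N"
    have "card {p \<in> ?A. ?R p w} = card (Cons (w, u) ` {p \<in> ?A. ?R p w})"
      by (simp add: card_image)
    also have "\<dots> \<le> num_paths G (Suc j) w v"
      unfolding num_paths_def using w nbrs_sym[of w u]
      by (intro card_mono finite_apaths) (auto simp: apath_Cons_iff nbrs_def)
    finally show "real (card {p \<in> ?A. ?R p w}) \<le> M" using M[OF w] by linarith
  qed
  finally have "num_paths G j u v * (?c - j) \<le> M * ?c" by (simp add: mult.commute)
  then have "num_paths G j u v \<le> M * (?c / (?c - j))"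
    using deg j by (simp add: field_simps)
  \<comment> \<open>The quotient decreases in the degree, so the lower bound \<open>d\<close> can
    replace it.\<close>
  also have "\<dots> \<le> M * (d / (d - j))"
  proof (intro mult_left_mono M0)
    have "real j * d \<le> real j * ?c" using deg by (intro mult_left_mono) auto
    then show "?c / (?c - j) \<le> d / (d - j)"
      using deg j by (simp add: field_simps)
  qed
  finally show ?thesis .
qed

lemma num_paths_shorter:
  fixes d M :: real
  assumes deg: "\<And>w. w \<in> pverts G \<Longrightarrow> d \<le> card (nbrs G w)" and k: "k < d"
    and M: "\<And>w. w \<in> pverts G \<Longrightarrow> num_paths G k w v \<le> M"
  shows "u \<in> pverts G \<Longrightarrow> i \<le> k \<Longrightarrow> num_paths G (k - i) u v \<le> M * (d / (d - k)) ^ i"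
proof (induction i arbitrary: u)
  case (Suc i)
  let ?j = "k - Suc i"
  have j: "Suc ?j = k - i" using Suc.prems by simp
  have "0 \<le> M" using M[OF Suc.prems(1)] by linarith
  have "num_paths G ?j u v \<le> M * (d / (d - k)) ^ i * (d / (d - ?j))"
  proof (rule num_paths_extend)
    show "num_paths G (Suc ?j) w v \<le> M * (d / (d - k)) ^ i" if "w \<in> nbrs G u" for w
      unfolding j using Suc that nbrs_subset by auto
  qed (use deg Suc.prems k in auto)
  also have "\<dots> \<le> M * (d / (d - k)) ^ i * (d / (d - k))"
    using k \<open>0 \<le> M\<close> by (intro mult_left_mono divide_left_mono mult_nonneg_nonneg mult_pos_pos) auto
  finally show ?case by (simp add: mult.commute mult.left_commute)
qed (use M in simp)

text \<open>Extending to length \<open>k\<close> loses at most \<open>(d / (d - k)) ^ k\<close>, and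
  Bernoulli's inequality gives
  \<open>(1 - k / d) ^ k \<ge> 1 - k ^ 2 / d \<ge> 1 / 2\<close>.\<close>

lemma num_paths_shorter_le_twice:
  fixes d M :: real
  assumes deg: "\<And>w. w \<in> pverts G \<Longrightarrow> d \<le> card (nbrs G w)" and k: "2 * real k ^ 2 \<le> d" "0 < k"
    and M: "\<And>w. w \<in> pverts G \<Longrightarrow> num_paths G k w v \<le> M"
    and u: "u \<in> pverts G" and j: "j \<le> k"
  shows "num_paths G j u v \<le> 2 * M"
proof -
  have "real k * 1 \<le> real k * real k" using k by (intro mult_left_mono) auto
  then have "real k \<le> real k ^ 2" by (simp add: power2_eq_square)
  then have kd: "real k < d" using k by linarith
  have M0: "0 \<le> M" using M[OF u] by linarith
  have "1 - real k * (real k / d) \<le> (1 - real k / d) ^ k"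
    using Bernoulli_inequality[of "- (real k / d)" k] kd k by simp
  moreover have "real k * (real k / d) \<le> 1 / 2"
    using k kd by (simp add: field_simps power2_eq_square)
  moreover have "(d - k) / d = 1 - real k / d"
    using kd by (simp add: diff_divide_distrib)
  ultimately have half: "1 / 2 \<le> ((d - k) / d) ^ k"
    by (simp only:)
  have "(d / (d - k)) ^ (k - j) \<le> (d / (d - k)) ^ k"
    using kd by (intro power_increasing) auto
  also have "\<dots> = 1 / ((d - k) / d) ^ k"
    by (simp add: power_divide)
  also have "\<dots> \<le> 1 / (1 / 2)"
    using half by (intro divide_left_mono) auto
  finally have "M * (d / (d - k)) ^ (k - j) \<le> M * 2"
    using M0 by (intro mult_left_mono) auto
  then show ?thesis
    using num_paths_shorter[OF deg kd M u, of "k - j"] j by simp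
qed

lemma last_random_walk:
  assumes "\<And>v. v \<in> pverts G \<Longrightarrow> nbrs G v \<noteq> {}"
  shows "v \<in> pverts G \<Longrightarrow> ws \<in> set_pmf (random_walk G k v) \<Longrightarrow> ws \<noteq> [] \<and> last ws \<in> pverts G"
proof (induction k arbitrary: v ws)
  case (Suc k)
  then obtain w ws' where "w \<in> nbrs G v" "ws' \<in> set_pmf (random_walk G k w)" "ws = v # ws'"
    using assms by auto
  then show ?case using Suc.IH[of w ws'] nbrs_subset by auto
qed simp

end

text \<open>A complete valid state is an embedding because every arc of \<open>T\<close> joins a
  parent and a child. The failure bound is uniform in the end of the walk, so integrating over the
  walk preserves it.\<close>

lemma (in tree_embedding) algorithm_law_potential:
  fixes d D \<Psi> :: real
  assumes law: "algorithm_law T G r m v0 p" and v0: "v0 \<in> pverts G"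
    and tree: "is_tree T" and T: "children T r = Ch" "pverts T = V"
    and deg: "\<And>v. v \<in> pverts G \<Longrightarrow> d \<le> card (nbrs G v)" and d: "0 < d"
    and D: "\<And>u. u \<in> V \<Longrightarrow> card (Ch u) \<le> D"
    and q: "1 \<le> q * (d - (k * B\<^sub>0 + C * card V + k * s) - D)"
    and \<Psi>: "0 \<le> \<Psi>" "\<And>z. z \<in> pverts G \<Longrightarrow> potential [r \<mapsto> z] \<le> \<Psi>"
  shows "1 - \<Psi> \<le> measure (measure_spmf p) {f. is_embedding T G f}"
proof -
  let ?good = "{g. valid g \<and> V \<subseteq> dom g}"
  interpret T: pair_graph T using tree by (simp add: is_tree_def)
  have "is_embedding T G f" if f: "f \<in> ?good" for f
  proof -
    have v: "valid f" and dom: "dom f = pverts T" using f T by (auto simp: valid_def)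
    have "(the (f x), the (f y)) \<in> parcs G" if xy: "(x, y) \<in> parcs T" for x y
    proof -
      have "x \<in> V" "y \<in> V" using xy T.in_arcsD1 T.in_arcsD2 T by auto
      moreover have "y \<in> Ch x \<or> x \<in> Ch y"
        using T.tree_arc_cases[OF tree _ xy, of r] T by auto
      ultimately have "the (f y) \<in> nbrs G (the (f x))"
        using validD(6)[OF v] dom T nbrs_sym by blast
      then show ?thesis by (simp add: nbrs_def)
    qed
    then show ?thesis using v dom T by (auto simp: is_embedding_def valid_def)
  qed
  then have sub: "Some ` ?good \<subseteq> Some ` {f. is_embedding T G f}" by blast
  obtain D' where D': "\<And>ws. ws \<in> set_pmf (random_walk G m v0) \<Longrightarrow> run_law T G r [r \<mapsto> last ws] (D' ws)"
    and p: "p = bind_pmf (random_walk G m v0) D'"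
    using law by (auto simp: algorithm_law_def)
  have "emeasure (measure_pmf p) (- Some ` ?good)
      = (\<integral>\<^sup>+ws. emeasure (measure_pmf (D' ws)) (- Some ` ?good) \<partial>random_walk G m v0)"
    unfolding p by simp
  also have "\<dots> \<le> (\<integral>\<^sup>+ws. ennreal \<Psi> \<partial>random_walk G m v0)"
  proof (intro nn_integral_mono_AE AE_pmfI)
    fix ws assume ws: "ws \<in> set_pmf (random_walk G m v0)"
    have "nbrs G v \<noteq> {}" if "v \<in> pverts G" for v using deg[OF that] d by auto
    then have z: "last ws \<in> pverts G" using last_random_walk[OF _ v0 ws] by blast
    have "emeasure (measure_pmf (D' ws)) (- Some ` ?good) \<le> ennreal (potential [r \<mapsto> last ws])"
      by (rule run_law_potential[OF D'[OF ws] valid_root[OF z] T deg D q])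
    also have "\<dots> \<le> ennreal \<Psi>" using \<Psi>(2)[OF z] by (rule ennreal_leI)
    finally show "emeasure (measure_pmf (D' ws)) (- Some ` ?good) \<le> ennreal \<Psi>" .
  qed
  finally have "measure (measure_pmf p) (- Some ` ?good) \<le> \<Psi>"
    using \<Psi>(1) by (simp add: measure_pmf.emeasure_eq_measure)
  then have "1 - \<Psi> \<le> measure (measure_pmf p) (Some ` ?good)"
    using measure_pmf.prob_compl[of "Some ` ?good" p] by (simp add: Compl_eq_Diff_UNIV)
  also have "\<dots> \<le> measure (measure_pmf p) (Some ` {f. is_embedding T G f})"
    by (rule measure_pmf.finite_measure_mono[OF sub]) simp
  finally show ?thesis by (simp add: measure_measure_spmf_conv_measure_pmf)
qed

section \<open>Choice of parameters and asymptotics\<close>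

lemma exp_cube_dominates:
  fixes \<eta> :: real
  assumes "\<eta> > 0"
  shows "\<forall>\<^sub>F n in sequentially.
    2 \<le> ln (real n) \<and> real n * ln (real n) * exp (- (ln (real n) ^ 3 / 32)) \<le> \<eta>"
proof -
  have "(\<lambda>n. real n * ln (real n) * exp (- (ln (real n) ^ 3 / 32))) \<longlonglongrightarrow> 0"
    by real_asymp
  then have "\<forall>\<^sub>F n in sequentially. real n * ln (real n) * exp (- (ln (real n) ^ 3 / 32)) < \<eta>"
    using assms by (rule order_tendstoD)
  moreover have "\<forall>\<^sub>F n in sequentially. 2 \<le> ln (real n)"
    by real_asymp
  ultimately show ?thesis by eventually_elim auto
qed

lemma embedding_probability:
  fixes G :: "'v pair_pre_digraph" and T :: "'a pair_pre_digraph" and n d k t :: nat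
    and \<epsilon> \<delta> :: real
  assumes G: "pair_graph G" "card (pverts G) = n" "property_P d k t G"
    and pos: "0 < d" "0 < k" "0 < t" "0 < \<epsilon>" "0 < \<delta>"
    and L: "ln (real n) ^ 8 \<le> d" "real k \<le> ln (real n)" "2 \<le> ln (real n)"
    and eps: "(2 * real k * \<epsilon>) powr (1 / real k) + \<delta> + 1 / real k \<le> 1"
    and tree: "is_tree T" and degT: "\<And>x. x \<in> pverts T \<Longrightarrow> out_degree (with_proj T) x \<le> \<delta> * d"
    and sizeT: "card (pverts T) \<le> \<epsilon> * t"
    and r: "r \<in> pverts T" and v0: "v0 \<in> pverts G" and law: "algorithm_law T G r k v0 p"
  shows "1 - real n * ln (real n) * exp (- (ln (real n) ^ 3 / 32))
    \<le> measure (measure_spmf p) {f. is_embedding T G f}"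
proof -
  interpret G: pair_graph G by (rule G(1))
  interpret T: pair_graph T using tree by (simp add: is_tree_def)
  define L where "L = ln (real n)"
  define x where "x = real d powr (1 / 4)"
  \<comment> \<open>\<open>a * d\<close> neighbors remain when \<open>\<delta> * d\<close> are
    reserved for children and \<open>d / k\<close> may be occupied. \<open>lam\<close> makes
    \<open>lam * x = 1 / (4 * k)\<close>, and \<open>s\<close> makes the total deviation
    \<open>k * s\<close> equal to \<open>d / (4 * k)\<close>.\<close>
  define a where "a = 1 - \<delta> - 1 / real k"
  define q where "q = 1 / (a * d)"
  define C where "C = q ^ k * (real d ^ Suc k / t)"
  define lam where "lam = 1 / (4 * k * x)"
  define s where "s = d / (4 * real k ^ 2)"
  have L2: "2 \<le> L" and kL: "real k \<le> L" using L by (auto simp: L_def)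
  have x4: "x ^ 4 = d" using pos by (simp add: x_def powr_realpow[symmetric] powr_powr)
  have x0: "0 < x" using pos by (simp add: x_def)
  have xL: "L ^ 2 \<le> x"
  proof (rule power_le_imp_le_base)
    show "(L ^ 2) ^ Suc 3 \<le> x ^ Suc 3" using L x4 by (simp add: L_def flip: power_mult)
  qed (use x0 in simp)
  have x3L: "L ^ 6 \<le> x ^ 3"
    using power_mono[OF xL, of 3] by (simp flip: power_mult)
  have "16 * L ^ 2 \<le> L ^ 4 * L ^ 2"
    using power_mono[OF L2, of 4] by (intro mult_right_mono) auto
  also have "\<dots> = L ^ 6" by (simp flip: power_add)
  finally have L16: "16 * L ^ 2 \<le> x ^ 3" using x3L by simp
  have kL2: "real k ^ 2 \<le> L ^ 2" using kL by (intro power_mono) auto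
  have k16: "16 * real k ^ 2 \<le> x ^ 3" using L16 kL2 by linarith
  have "1 \<le> x" using xL L2 power_mono[OF L2, of 2] by simp
  then have "x ^ 3 * 1 \<le> x ^ 3 * x" by (intro mult_left_mono) auto
  also have "\<dots> = d" using x4 by (simp add: eval_nat_numeral)
  finally have kd: "2 * real k ^ 2 \<le> d" using k16 by simp
  have deg: "real d \<le> card (nbrs G v)" if "v \<in> pverts G" for v
    using G(3) that G.out_degree_eq_card_nbrs[of v] by (auto simp: property_P_def)
  have P_k: "num_paths G k u v \<le> x" if "u \<in> pverts G" "v \<in> pverts G" for u v
    using G(3) that by (simp add: property_P_def x_def)
  have P_Suc: "num_paths G (Suc k) u v \<le> real d ^ Suc k / t" if "u \<in> pverts G" "v \<in> pverts G" for u v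
    using G(3) that by (simp add: property_P_def)
  have powr_a: "(2 * real k * \<epsilon>) powr (1 / real k) \<le> a" using eps by (simp add: a_def)
  moreover have "0 < (2 * real k * \<epsilon>) powr (1 / real k)" using pos by simp
  ultimately have a0: "0 < a" by linarith
  \<comment> \<open>The condition on \<open>\<epsilon>\<close> and \<open>\<delta>\<close>, raised
    to the power \<open>k\<close>, is what keeps the expected occupation
    \<open>C * card (pverts T)\<close> below \<open>d / (2 * k)\<close>.\<close>
  have "((2 * real k * \<epsilon>) powr (1 / real k)) ^ k = 2 * real k * \<epsilon>"
    using pos by (simp add: powr_realpow[symmetric] powr_powr)
  then have ak: "2 * real k * \<epsilon> \<le> a ^ k"
    using power_mono[OF powr_a, of k] by simp
  have C: "C = d / (a ^ k * t)"
    using pos a0 by (simp add: C_def q_def field_simps)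
  have "C * card (pverts T) \<le> d / (a ^ k * t) * (\<epsilon> * t)"
    unfolding C using sizeT a0 pos by (intro mult_left_mono) auto
  also have "\<dots> = d * \<epsilon> / a ^ k" using pos by simp
  also have "\<dots> \<le> d * \<epsilon> / (2 * real k * \<epsilon>)"
    using ak pos a0 by (intro divide_left_mono mult_nonneg_nonneg mult_pos_pos) auto
  also have "\<dots> = d / (2 * k)" using pos by simp
  finally have CV: "C * card (pverts T) \<le> d / (2 * k)" .
  obtain par dep where "rooted_tree (children T r) (pverts T) r par dep"
    using T.rooted_tree_children[OF tree r] .
  then interpret rooted_tree "children T r" "pverts T" r par dep .
  interpret tree_embedding "children T r" "pverts T" r par dep G k q C x "2 * x" lam s
  proof
    show "0 < k" "0 < q" "0 \<le> C" "0 \<le> lam" "lam * x \<le> 1"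
      using pos a0 x0 by (auto simp: q_def C lam_def field_simps)
    fix u v assume uv: "u \<in> pverts G" "v \<in> pverts G"
    show "q ^ k * num_paths G (Suc k) u v \<le> C"
      unfolding C_def using P_Suc[OF uv] a0 pos by (intro mult_left_mono) (auto simp: q_def)
    show "num_paths G k u v \<le> x" using P_k[OF uv] .
    show "num_paths G (Suc j) u v \<le> 2 * x" if "j < k" for j
      using G.num_paths_shorter_le_twice[OF deg kd pos(2) P_k[OF _ uv(2)] uv(1)] that by simp
  qed
  let ?e = "exp (lam * (lam * x * (C * card (pverts T)) - s))"
  let ?\<Psi> = "real (card (pverts G)) * k * ?e"
  have s0: "0 \<le> s" by (simp add: s_def)
  have ch: "real (card (children T r u)) \<le> \<delta> * d" if "u \<in> pverts T" for u
  proof -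
    have "card (children T r u) \<le> card (nbrs T u)"
      using T.children_subset_nbrs by (intro card_mono) auto
    then show ?thesis using degT[OF that] T.out_degree_eq_card_nbrs[of u] by simp
  qed
  have occ: "1 \<le> q * (d - (k * (2 * x) + C * card (pverts T) + k * s) - \<delta> * d)"
  proof -
    \<comment> \<open>Shallow vertices, expectation and deviation occupy at most
      \<open>d / (4 * k)\<close>, \<open>d / (2 * k)\<close> and \<open>d / (4 * k)\<close>, in
      total \<open>d / k\<close>.\<close>
    have "8 * real k ^ 2 \<le> x ^ 3" using k16 zero_le_power2[of "real k"] by linarith
    then have "x * (8 * real k ^ 2) \<le> x * x ^ 3" using x0 by (intro mult_left_mono) auto
    also have "\<dots> = d" using x4 by (simp add: eval_nat_numeral)
    finally have "k * (2 * x) \<le> d / (4 * k)"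
      using pos by (simp add: field_simps power2_eq_square)
    moreover have "k * s = d / (4 * k)" using pos by (simp add: s_def power2_eq_square)
    moreover have "d / (4 * k) + d / (2 * k) + d / (4 * k) = d / real k" using pos by (simp add: field_simps)
    ultimately have "a * d \<le> d - (k * (2 * x) + C * card (pverts T) + k * s) - \<delta> * d"
      using CV by (simp add: a_def algebra_simps)
    then have "q * (a * d) \<le> q * (d - (k * (2 * x) + C * card (pverts T) + k * s) - \<delta> * d)"
      using q_pos by (intro mult_left_mono) auto
    then show ?thesis using a0 pos by (simp add: q_def)
  qed
  have "1 - ?\<Psi> \<le> measure (measure_spmf p) {f. is_embedding T G f}"
    using potential_root[OF s0] pos
    by (intro algorithm_law_potential[OF law v0 tree refl refl deg _ ch occ]) auto
  moreover have "?\<Psi> \<le> n * L * exp (- (L ^ 3 / 32))"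
  proof -
    \<comment> \<open>The second-order term uses up at most half of \<open>s\<close>. The remaining
      exponent is \<open>- (x ^ 3 / (32 * k ^ 3))\<close>, and \<open>x \<ge> L ^ 2\<close> with
      \<open>k \<le> L\<close> gives the cube of \<open>L\<close>.\<close>
    have "lam * x = 1 / (4 * k)" using x0 pos by (simp add: lam_def)
    then have "lam * x * (C * card (pverts T)) \<le> 1 / (4 * k) * (d / (2 * k))"
      using mult_left_mono[OF CV, of "1 / (4 * k)"] by simp
    also have "\<dots> - s = - (d / (8 * real k ^ 2))"
      using pos by (simp add: s_def field_simps power2_eq_square)
    finally have "lam * (lam * x * (C * card (pverts T)) - s) \<le> lam * (- (d / (8 * real k ^ 2)))"
      using lam_nonneg by (intro mult_left_mono) auto
    also have "\<dots> = - (x ^ 3 / (32 * real k ^ 3))"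
      using pos x0 x4 by (simp add: lam_def field_simps eval_nat_numeral)
    also have "\<dots> \<le> - (L ^ 3 / 32)"
    proof -
      have "real k ^ 3 * L ^ 3 \<le> L ^ 3 * L ^ 3" using kL L2 by (intro mult_right_mono power_mono) auto
      also have "\<dots> = L ^ 6" by (simp flip: power_add)
      finally show ?thesis using x3L pos by (simp add: field_simps)
    qed
    finally have "?e \<le> exp (- (L ^ 3 / 32))" by simp
    then show ?thesis using kL G(2) by (intro mult_mono) auto
  qed
  ultimately show ?thesis by (simp add: L_def)
qed

text \<open>The error bound depends on \<open>n\<close> alone, so one threshold for \<open>n\<close>
  serves all graphs, trees, parameters and choices of the algorithm.\<close>

theorem theorem5p2:
  fixes \<eta> :: real
  assumes "\<eta> > 0"
  shows "\<forall>\<^sub>F n in sequentially.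
    \<forall>(G :: 'v pair_pre_digraph) (T :: 'a pair_pre_digraph)
      (d :: nat) (k :: nat) (t :: nat) (\<epsilon> :: real) (\<delta> :: real) (r :: 'a) (v0 :: 'v) p.
      pair_graph G \<and> card (pverts G) = n \<and>
      d > 0 \<and> k > 0 \<and> t > 0 \<and> property_P d k t G \<and>
      real d \<ge> ln (real n) ^ 8 \<and> real k \<le> ln (real n) \<and>
      \<epsilon> > 0 \<and> \<delta> > 0 \<and> (2 * real k * \<epsilon>) powr (1 / real k) + \<delta> + 1 / real k \<le> 1 \<and>
      is_tree T \<and> (\<forall>x\<in>pverts T. real (out_degree (with_proj T) x) \<le> \<delta> * real d) \<and>
      real (card (pverts T)) \<le> \<epsilon> * real t \<and>
      r \<in> pverts T \<and> v0 \<in> pverts G \<and> algorithm_law T G r k v0 p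
      \<longrightarrow> measure (measure_spmf p) {f. is_embedding T G f} \<ge> 1 - \<eta>"
  using exp_cube_dominates[OF assms]
proof eventually_elim
  case (elim n)
  show ?case
  proof (intro allI impI, elim conjE)
    fix G :: "'v pair_pre_digraph" and T :: "'a pair_pre_digraph" and d k t :: nat
      and \<epsilon> \<delta> :: real and r :: 'a and v0 :: 'v and p
    assume *: "pair_graph G" "card (pverts G) = n" "d > 0" "k > 0" "t > 0" "property_P d k t G"
      "real d \<ge> ln (real n) ^ 8" "real k \<le> ln (real n)" "\<epsilon> > 0" "\<delta> > 0"
      "(2 * real k * \<epsilon>) powr (1 / real k) + \<delta> + 1 / real k \<le> 1" "is_tree T"
      "\<forall>x\<in>pverts T. real (out_degree (with_proj T) x) \<le> \<delta> * real d"
      "real (card (pverts T)) \<le> \<epsilon> * real t" "r \<in> pverts T" "v0 \<in> pverts G"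
      "algorithm_law T G r k v0 p"
    have "1 - real n * ln (real n) * exp (- (ln (real n) ^ 3 / 32))
        \<le> measure (measure_spmf p) {f. is_embedding T G f}"
      by (rule embedding_probability[where d = d and k = k and t = t and \<epsilon> = \<epsilon> and \<delta> = \<delta> and r = r and ?v0.0 = v0])
        (use * elim in auto)
    then show "measure (measure_spmf p) {f. is_embedding T G f} \<ge> 1 - \<eta>"
      using elim by linarith
  qed
qed

end
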